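(* Fix an integer $k\geq 2$ and a real number $\epsilon>0$. Let $l$ be an integer, and let $\Gamma$ be a uniformly chosen $(k,l)$-bipartite graph. Then, asymptotically almost surely (i.e. with probability tending to $1$) as $l\to\infty$: (i) if $k\geq 3$ then every vertex of $\Gamma$ is fixed by $\mathrm{Aut}(\Gamma)$; and (ii) $|\mathrm{Aut}(\Gamma)|\leq (l!)^k/l^{(k-1)^2-\epsilon}$.
   Context: A multigraph is a triple $\Gamma=(V,E,I)$ with vertex set $V$, edge set $E$, and an incidence relation $I$ such that each $e\in E$ is incident with exactly two distinct vertices (multiple edges between the same pair of vertices are allowed). For integers $k,l$, a $(k,l)$-bipartite graph is an $l$-regular bipartite multigraph with bipartite blocks of size $k$, one of which is coloured black and the other white. An automorphism of a vertex-coloured multigraph $\Gamma$ is a pair $(\varphi_V,\varphi_E)$ where $\varphi_V$ is a colour-preserving bijection $V\to V$ and $\varphi_E$ is a bijection $E\to E$ such that $(v,e)\in I$ if and only if $(\varphi_V(v),\varphi_E(e))\in I$; $\mathrm{Aut}(\Gamma)$ is the group of all automorphisms. A uniformly chosen $(k,l)$-bipartite graph is one chosen uniformly from the finite set of $(k,l)$-bipartite graphs considered up to colour-preserving isomorphism. *)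

theory Defs
  imports "HOL-Probability.Probability" "HOL-Combinatorics.Permutations"
begin

datatype colour = Black | White

record ('v, 'e) cgraph =
  verts :: "'v set"
  edges :: "'e set"
  inc :: "('v \<times> 'e) set"
  colour :: "'v \<Rightarrow> colour"

definition multigraph :: "('v, 'e) cgraph \<Rightarrow> bool" where
  "multigraph \<Gamma> \<longleftrightarrow> inc \<Gamma> \<subseteq> verts \<Gamma> \<times> edges \<Gamma> \<and>
     (\<forall>e\<in>edges \<Gamma>. card {v \<in> verts \<Gamma>. (v, e) \<in> inc \<Gamma>} = 2)"

definition bicoloured :: "('v, 'e) cgraph \<Rightarrow> bool" where
  "bicoloured \<Gamma> \<longleftrightarrow>
     (\<forall>e u v. (u, e) \<in> inc \<Gamma> \<longrightarrow> (v, e) \<in> inc \<Gamma> \<longrightarrow> u \<noteq> v \<longrightarrow> colour \<Gamma> u \<noteq> colour \<Gamma> v)"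

definition regular :: "nat \<Rightarrow> ('v, 'e) cgraph \<Rightarrow> bool" where
  "regular l \<Gamma> \<longleftrightarrow> (\<forall>v\<in>verts \<Gamma>. card {e \<in> edges \<Gamma>. (v, e) \<in> inc \<Gamma>} = l)"

text \<open>Finiteness is required explicitly because the cardinality of an infinite set is \<open>0\<close>.\<close>

definition kl_bipartite :: "nat \<Rightarrow> nat \<Rightarrow> ('v, 'e) cgraph \<Rightarrow> bool" where
  "kl_bipartite k l \<Gamma> \<longleftrightarrow>
     multigraph \<Gamma> \<and> finite (verts \<Gamma>) \<and> finite (edges \<Gamma>) \<and>
     bicoloured \<Gamma> \<and> regular l \<Gamma> \<and>
     card {v \<in> verts \<Gamma>. colour \<Gamma> v = Black} = k \<and>
     card {v \<in> verts \<Gamma>. colour \<Gamma> v = White} = k"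

definition is_iso ::
  "('v, 'e) cgraph \<Rightarrow> ('w, 'f) cgraph \<Rightarrow> ('v \<Rightarrow> 'w) \<Rightarrow> ('e \<Rightarrow> 'f) \<Rightarrow> bool" where
  "is_iso \<Gamma> \<Delta> \<phi> \<psi> \<longleftrightarrow>
     bij_betw \<phi> (verts \<Gamma>) (verts \<Delta>) \<and> bij_betw \<psi> (edges \<Gamma>) (edges \<Delta>) \<and>
     (\<forall>v\<in>verts \<Gamma>. colour \<Delta> (\<phi> v) = colour \<Gamma> v) \<and>
     (\<forall>v\<in>verts \<Gamma>. \<forall>e\<in>edges \<Gamma>. (v, e) \<in> inc \<Gamma> \<longleftrightarrow> (\<phi> v, \<psi> e) \<in> inc \<Delta>)"

definition isomorphic :: "('v, 'e) cgraph \<Rightarrow> ('w, 'f) cgraph \<Rightarrow> bool" where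
  "isomorphic \<Gamma> \<Delta> \<longleftrightarrow> (\<exists>\<phi> \<psi>. is_iso \<Gamma> \<Delta> \<phi> \<psi>)"

text \<open>
  The condition \<open>permutes\<close> makes \<open>\<phi>\<close> and \<open>\<psi>\<close> the identity outside the vertex and the edge set,
  so that distinct elements of \<open>Aut \<Gamma>\<close> are distinct pairs of bijections of these sets and
  \<open>card (Aut \<Gamma>)\<close> is the order of the automorphism group.
\<close>

definition Aut :: "('v, 'e) cgraph \<Rightarrow> (('v \<Rightarrow> 'v) \<times> ('e \<Rightarrow> 'e)) set" where
  "Aut \<Gamma> = {(\<phi>, \<psi>). \<phi> permutes verts \<Gamma> \<and> \<psi> permutes edges \<Gamma> \<and> is_iso \<Gamma> \<Gamma> \<phi> \<psi>}"

text \<open>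
  The \<open>(k,l)\<close>-bipartite graphs up to colour-preserving isomorphism. Being finite, each of them has
  a copy whose vertices and edges are natural numbers.
\<close>

definition kl_graphs :: "nat \<Rightarrow> nat \<Rightarrow> (nat, nat) cgraph set" where
  "kl_graphs k l = {\<Gamma>. kl_bipartite k l \<Gamma>}"

definition kl_classes :: "nat \<Rightarrow> nat \<Rightarrow> (nat, nat) cgraph set set" where
  "kl_classes k l =
     kl_graphs k l // {(\<Gamma>, \<Delta>). \<Gamma> \<in> kl_graphs k l \<and> \<Delta> \<in> kl_graphs k l \<and> isomorphic \<Gamma> \<Delta>}"

lemma isomorphic_refl: "isomorphic \<Gamma> \<Gamma>"
  unfolding isomorphic_def is_iso_def
  by (rule exI[of _ id], rule exI[of _ id]) auto

lemma isomorphic_sym: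
  assumes "isomorphic \<Gamma> \<Delta>" shows "isomorphic \<Delta> \<Gamma>"
proof -
  from assms obtain \<phi> \<psi> where i: "is_iso \<Gamma> \<Delta> \<phi> \<psi>" unfolding isomorphic_def by blast
  let ?\<phi> = "inv_into (verts \<Gamma>) \<phi>" and ?\<psi> = "inv_into (edges \<Gamma>) \<psi>"
  have b: "bij_betw \<phi> (verts \<Gamma>) (verts \<Delta>)" "bij_betw \<psi> (edges \<Gamma>) (edges \<Delta>)"
    using i unfolding is_iso_def by auto
  have 1: "?\<phi> w \<in> verts \<Gamma> \<and> \<phi> (?\<phi> w) = w" if "w \<in> verts \<Delta>" for w
    using b(1) that by (metis bij_betw_def f_inv_into_f inv_into_into)
  have 2: "?\<psi> f \<in> edges \<Gamma> \<and> \<psi> (?\<psi> f) = f" if "f \<in> edges \<Delta>" for f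
    using b(2) that by (metis bij_betw_def f_inv_into_f inv_into_into)
  have "is_iso \<Delta> \<Gamma> ?\<phi> ?\<psi>"
    unfolding is_iso_def
  proof (intro conjI ballI)
    fix v assume "v \<in> verts \<Delta>"
    then show "colour \<Gamma> (?\<phi> v) = colour \<Delta> v" using i 1[of v] unfolding is_iso_def by metis
    fix e assume "e \<in> edges \<Delta>"
    then show "(v, e) \<in> inc \<Delta> \<longleftrightarrow> (?\<phi> v, ?\<psi> e) \<in> inc \<Gamma>"
      using i 1[OF \<open>v \<in> verts \<Delta>\<close>] 2[of e] unfolding is_iso_def by metis
  qed (use b bij_betw_inv_into in blast)+
  then show ?thesis unfolding isomorphic_def by blast
qed

lemma isomorphic_trans:
  assumes "isomorphic \<Gamma> \<Delta>" "isomorphic \<Delta> \<Theta>" shows "isomorphic \<Gamma> \<Theta>"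
proof -
  from assms obtain a b c d where i: "is_iso \<Gamma> \<Delta> a b" "is_iso \<Delta> \<Theta> c d"
    unfolding isomorphic_def by blast
  have "is_iso \<Gamma> \<Theta> (c \<circ> a) (d \<circ> b)"
    unfolding is_iso_def
  proof (intro conjI ballI)
    show "bij_betw (c \<circ> a) (verts \<Gamma>) (verts \<Theta>)" "bij_betw (d \<circ> b) (edges \<Gamma>) (edges \<Theta>)"
      using i unfolding is_iso_def by (auto intro: bij_betw_trans)
    fix v assume v: "v \<in> verts \<Gamma>"
    then have av: "a v \<in> verts \<Delta>" using i(1) unfolding is_iso_def by (auto dest: bij_betwE)
    show "colour \<Theta> ((c \<circ> a) v) = colour \<Gamma> v" using i v av unfolding is_iso_def by simp
    fix e assume e: "e \<in> edges \<Gamma>"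
    then have "b e \<in> edges \<Delta>" using i(1) unfolding is_iso_def by (auto dest: bij_betwE)
    then show "(v, e) \<in> inc \<Gamma> \<longleftrightarrow> ((c \<circ> a) v, (d \<circ> b) e) \<in> inc \<Theta>"
      using i v av e unfolding is_iso_def by simp
  qed
  then show ?thesis unfolding isomorphic_def by blast
qed

lemma equiv_kl_graphs:
  "equiv (kl_graphs k l)
     {(\<Gamma>, \<Delta>). \<Gamma> \<in> kl_graphs k l \<and> \<Delta> \<in> kl_graphs k l \<and> isomorphic \<Gamma> \<Delta>}"
  unfolding equiv_def refl_on_def sym_on_def trans_on_def
  using isomorphic_refl isomorphic_sym isomorphic_trans by blast

lemma kl_bipartite_card_edges:
  assumes "kl_bipartite k l \<Gamma>"
  shows "card (edges \<Gamma>) = k * l"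
proof -
  let ?B = "{v \<in> verts \<Gamma>. colour \<Gamma> v = Black}"
  let ?D = "\<lambda>v. {e \<in> edges \<Gamma>. (v, e) \<in> inc \<Gamma>}"
  have fin: "finite (verts \<Gamma>)" "finite (edges \<Gamma>)" and B: "card ?B = k"
    and bic: "bicoloured \<Gamma>" and mg: "multigraph \<Gamma>" and reg: "regular l \<Gamma>"
    using assms unfolding kl_bipartite_def by auto
  have "edges \<Gamma> = (\<Union>v\<in>?B. ?D v)"
  proof
    show "edges \<Gamma> \<subseteq> (\<Union>v\<in>?B. ?D v)"
    proof
      fix e assume e: "e \<in> edges \<Gamma>"
      then have "card {v \<in> verts \<Gamma>. (v, e) \<in> inc \<Gamma>} = 2" using mg unfolding multigraph_def by auto
      then obtain u v where uv: "{v \<in> verts \<Gamma>. (v, e) \<in> inc \<Gamma>} = {u, v}" "u \<noteq> v"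
        unfolding card_2_iff by blast
      then have m: "u \<in> verts \<Gamma>" "v \<in> verts \<Gamma>" "(u, e) \<in> inc \<Gamma>" "(v, e) \<in> inc \<Gamma>" by auto
      then have "colour \<Gamma> u \<noteq> colour \<Gamma> v" using bic uv(2) unfolding bicoloured_def by blast
      then have "colour \<Gamma> u = Black \<or> colour \<Gamma> v = Black" by (metis colour.exhaust)
      then show "e \<in> (\<Union>v\<in>?B. ?D v)" using m e by auto
    qed
  qed auto
  also have "card \<dots> = (\<Sum>v\<in>?B. card (?D v))"
  proof (rule card_UN_disjoint)
    show "\<forall>i\<in>?B. \<forall>j\<in>?B. i \<noteq> j \<longrightarrow> ?D i \<inter> ?D j = {}"
      using bic unfolding bicoloured_def by fastforce
  qed (use fin in auto)
  also have "\<dots> = (\<Sum>v\<in>?B. l)" by (rule sum.cong) (use reg in \<open>auto simp: regular_def\<close>)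
  finally show ?thesis using B by simp
qed

lemma finite_kl_classes: "finite (kl_classes k l)"
proof -
  let ?R = "{(\<Gamma>, \<Delta>). \<Gamma> \<in> kl_graphs k l \<and> \<Delta> \<in> kl_graphs k l \<and> isomorphic \<Gamma> \<Delta>}"
  define mk :: "(nat \<times> nat) set \<Rightarrow> (nat, nat) cgraph" where
    "mk J = \<lparr>verts = {..<k + k}, edges = {..<k * l}, inc = J,
             colour = (\<lambda>v. if v < k then Black else White)\<rparr>" for J
  let ?J = "Pow ({..<k + k} \<times> {..<k * l})"
  have "kl_classes k l \<subseteq> (\<lambda>J. {\<Delta> \<in> kl_graphs k l. isomorphic (mk J) \<Delta>}) ` ?J"
  proof
    fix C assume "C \<in> kl_classes k l"
    then obtain \<Gamma> where G: "\<Gamma> \<in> kl_graphs k l" and C: "C = ?R `` {\<Gamma>}"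
      unfolding kl_classes_def quotient_def by blast
    have kl: "kl_bipartite k l \<Gamma>" using G unfolding kl_graphs_def by simp
    let ?B = "{v \<in> verts \<Gamma>. colour \<Gamma> v = Black}" and ?W = "{v \<in> verts \<Gamma>. colour \<Gamma> v = White}"
    have fin: "finite (verts \<Gamma>)" "finite (edges \<Gamma>)" and c: "card ?B = k" "card ?W = k"
      and mg: "multigraph \<Gamma>"
      using kl unfolding kl_bipartite_def by auto
    obtain b where b: "bij_betw b ?B {..<k}"
      using finite_same_card_bij[of ?B "{..<k}"] fin c by auto
    obtain w where w: "bij_betw w ?W {k..<k + k}"
      using finite_same_card_bij[of ?W "{k..<k + k}"] fin c by auto
    obtain \<psi> where p: "bij_betw \<psi> (edges \<Gamma>) {..<k * l}"
      using finite_same_card_bij[of "edges \<Gamma>" "{..<k * l}"] fin kl_bipartite_card_edges[OF kl]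
      by auto
    define \<phi> where "\<phi> v = (if colour \<Gamma> v = Black then b v else w v)" for v
    have "bij_betw \<phi> ?B {..<k}" using b by (rule bij_betw_cong[THEN iffD1, rotated]) (simp add: \<phi>_def)
    moreover have "bij_betw \<phi> ?W {k..<k + k}"
      using w by (rule bij_betw_cong[THEN iffD1, rotated]) (simp add: \<phi>_def)
    ultimately have "bij_betw \<phi> (?B \<union> ?W) ({..<k} \<union> {k..<k + k})"
      by (rule bij_betw_combine) auto
    moreover have "?B \<union> ?W = verts \<Gamma>" using colour.exhaust by auto
    moreover have "{..<k} \<union> {k..<k + k} = {..<k + k}" by auto
    ultimately have f: "bij_betw \<phi> (verts \<Gamma>) {..<k + k}" by simp
    define J where "J = (\<lambda>(v, e). (\<phi> v, \<psi> e)) ` inc \<Gamma>"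
    have sub: "inc \<Gamma> \<subseteq> verts \<Gamma> \<times> edges \<Gamma>" using mg unfolding multigraph_def by simp
    have J: "J \<in> ?J" using sub bij_betwE[OF f] bij_betwE[OF p] unfolding J_def by auto
    have "is_iso \<Gamma> (mk J) \<phi> \<psi>"
      unfolding is_iso_def
    proof (intro conjI ballI)
      show "bij_betw \<phi> (verts \<Gamma>) (verts (mk J))" "bij_betw \<psi> (edges \<Gamma>) (edges (mk J))"
        using f p by (simp_all add: mk_def)
    next
      fix v assume v: "v \<in> verts \<Gamma>"
      show "colour (mk J) (\<phi> v) = colour \<Gamma> v"
      proof (cases "colour \<Gamma> v")
        case Black
        then show ?thesis using bij_betwE[OF b] v by (simp add: mk_def \<phi>_def)
      next
        case White
        then have "k \<le> \<phi> v" using bij_betwE[OF w] v by (simp add: \<phi>_def)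
        then show ?thesis using White by (simp add: mk_def)
      qed
    next
      fix v e assume v: "v \<in> verts \<Gamma>" and e: "e \<in> edges \<Gamma>"
      show "(v, e) \<in> inc \<Gamma> \<longleftrightarrow> (\<phi> v, \<psi> e) \<in> inc (mk J)"
      proof
        assume "(\<phi> v, \<psi> e) \<in> inc (mk J)"
        then obtain v' e' where i: "(v', e') \<in> inc \<Gamma>" "\<phi> v = \<phi> v'" "\<psi> e = \<psi> e'"
          by (auto simp: J_def mk_def)
        then have "v' \<in> verts \<Gamma>" "e' \<in> edges \<Gamma>" using sub by auto
        then have "v = v'" "e = e'"
          using i v e f p unfolding bij_betw_def by (auto dest: inj_onD)
        then show "(v, e) \<in> inc \<Gamma>" using i by simp
      qed (auto simp: J_def mk_def)
    qed
    then have "isomorphic \<Gamma> (mk J)" unfolding isomorphic_def by blast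
    then have "C = {\<Delta> \<in> kl_graphs k l. isomorphic (mk J) \<Delta>}"
      unfolding C using G isomorphic_sym isomorphic_trans by blast
    then show "C \<in> (\<lambda>J. {\<Delta> \<in> kl_graphs k l. isomorphic (mk J) \<Delta>}) ` ?J" using J by blast
  qed
  moreover have "finite ?J" by simp
  ultimately show ?thesis by (meson finite_imageI finite_subset)
qed

lemma kl_classes_nonempty: "kl_classes k l \<noteq> {}"
proof -
  define \<Gamma> :: "(nat, nat) cgraph" where
    "\<Gamma> = \<lparr>verts = {..<k + k}, edges = {..<k * l},
          inc = {(v, e). e < k * l \<and> (v = e div l \<or> v = k + e div l)},
          colour = (\<lambda>v. if v < k then Black else White)\<rparr>"
  have d: "e div l < k" if "e < k * l" for e
    using that by (simp add: less_mult_imp_div_less)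
  have "multigraph \<Gamma>"
    unfolding multigraph_def
  proof
    show "inc \<Gamma> \<subseteq> verts \<Gamma> \<times> edges \<Gamma>"
    proof (rule subrelI)
      fix v e assume "(v, e) \<in> inc \<Gamma>"
      then show "(v, e) \<in> verts \<Gamma> \<times> edges \<Gamma>" using d[of e] by (auto simp: \<Gamma>_def)
    qed
    show "\<forall>e\<in>edges \<Gamma>. card {v \<in> verts \<Gamma>. (v, e) \<in> inc \<Gamma>} = 2"
    proof
      fix e assume "e \<in> edges \<Gamma>"
      then have e: "e < k * l" by (simp add: \<Gamma>_def)
      have "{v \<in> verts \<Gamma>. (v, e) \<in> inc \<Gamma>} = {e div l, k + e div l}"
        using e d[OF e] by (auto simp: \<Gamma>_def)
      then show "card {v \<in> verts \<Gamma>. (v, e) \<in> inc \<Gamma>} = 2" using d[OF e] by simp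
    qed
  qed
  moreover have "bicoloured \<Gamma>"
    unfolding bicoloured_def
  proof (intro allI impI)
    fix e u v assume "(u, e) \<in> inc \<Gamma>" "(v, e) \<in> inc \<Gamma>" "u \<noteq> v"
    then show "colour \<Gamma> u \<noteq> colour \<Gamma> v" using d[of e] by (auto simp: \<Gamma>_def)
  qed
  moreover have "regular l \<Gamma>"
    unfolding regular_def
  proof
    fix v assume "v \<in> verts \<Gamma>"
    then have v: "v < k + k" by (simp add: \<Gamma>_def)
    define u where "u = (if v < k then v else v - k)"
    have u: "u < k" using v by (auto simp: u_def)
    have "{e \<in> edges \<Gamma>. (v, e) \<in> inc \<Gamma>} = {e. e < k * l \<and> e div l = u}"
    proof (rule Collect_cong)
      fix e
      show "e \<in> edges \<Gamma> \<and> (v, e) \<in> inc \<Gamma> \<longleftrightarrow> e < k * l \<and> e div l = u"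
        using d[of e] v by (cases "v < k") (auto simp: \<Gamma>_def u_def)
    qed
    also have "\<dots> = {u * l..<u * l + l}"
    proof (intro set_eqI iffI)
      fix e assume "e \<in> {e. e < k * l \<and> e div l = u}"
      then have e: "e < k * l" "e div l = u" by auto
      then have "l > 0" by (cases l) auto
      then have "e < l + u * l" unfolding e(2)[symmetric] by (rule dividend_less_div_times)
      moreover have "u * l \<le> e" unfolding e(2)[symmetric] by (rule div_times_less_eq_dividend)
      ultimately show "e \<in> {u * l..<u * l + l}" by simp
    next
      fix e assume "e \<in> {u * l..<u * l + l}"
      then have e: "u * l \<le> e" "e < u * l + l" by auto
      have "u * l + l \<le> k * l" using mult_le_mono1[of "Suc u" k l] u by simp
      then have "e < k * l" using e(2) by linarith
      moreover have "e div l = u"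
        by (rule div_nat_eqI) (use e in \<open>simp_all add: mult.commute add.commute\<close>)
      ultimately show "e \<in> {e. e < k * l \<and> e div l = u}" by simp
    qed
    finally show "card {e \<in> edges \<Gamma>. (v, e) \<in> inc \<Gamma>} = l" by simp
  qed
  moreover have "{v \<in> verts \<Gamma>. colour \<Gamma> v = Black} = {..<k}"
    "{v \<in> verts \<Gamma>. colour \<Gamma> v = White} = {k..<k + k}"
    by (auto simp: \<Gamma>_def)
  moreover have "finite (verts \<Gamma>)" "finite (edges \<Gamma>)" by (simp_all add: \<Gamma>_def)
  ultimately have "\<Gamma> \<in> kl_graphs k l"
    unfolding kl_graphs_def kl_bipartite_def by simp
  then show ?thesis unfolding kl_classes_def by (auto simp: quotient_def)
qed

end

theory Submission
  imports Defs "HOL-Real_Asymp.Real_Asymp"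
begin

text \<open>
  Up to isomorphism, a \<open>(k,l)\<close>-bipartite graph is a \<open>k \<times> k\<close> matrix \<open>A\<close> of natural numbers all of whose
  row and column sums are \<open>l\<close>, where \<open>A (i, j)\<close> counts the edges between the \<open>i\<close>-th black and the
  \<open>j\<close>-th white vertex. The labelling of the vertices is arbitrary, so the isomorphism classes are
  the orbits of these matrices under independent permutations of rows and columns
  (\<open>kl_classes_eq\<close>). An orbit has at most \<open>(k!)\<^sup>2\<close> elements, a constant as \<open>l\<close> grows. It is therefore
  enough that all but a vanishing proportion of the matrices have the required properties; these
  do not depend on the matrix chosen in an orbit because they are properties of the graph.

  Both properties follow from a genericity condition on \<open>A\<close>. An automorphism permutes rows and
  columns without changing the matrix. If the entries of \<open>A\<close> are pairwise distinct, then each entry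
  has to stay in place, and with it each row and each column (\<open>Aut_fixes_vertices\<close>). For the
  order, an automorphism is given by one of at most \<open>(2k)!\<close> permutations of the vertices and,
  relative to a fixed automorphism inducing that permutation, by a permutation of each bundle of
  parallel edges; so \<open>|Aut \<Gamma>| \<le> (2k)! \<Prod> A (i, j)!\<close> (\<open>card_Aut_le\<close>). If two entries of one row are both
  at least \<open>m\<close>, the product is at most \<open>(l!)\<^sup>k / 2\<^sup>m\<close> (\<open>contingency_prod_fact_le\<close>). With \<open>m \<ge> \<surd>l\<close> the gain
  \<open>2\<^sup>m\<close> eventually exceeds \<open>(2k)!\<close> times any fixed power of \<open>l\<close>.

  That almost all matrices are generic is a dimension count. With \<open>N = (k - 1)\<^sup>2\<close>, the entries outside
  one row and one column determine the matrix, and there are at least a constant times \<open>l\<^sup>N\<close>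
  matrices (\<open>card_contingency_ge\<close>). For \<open>k \<ge> 3\<close>, any two positions avoid some row and some column, so
  an equality between two given entries leaves \<open>N - 1\<close> free entries. A condition
  \<open>A (0, 0)\<^sup>2 < l\<close> restricts one free entry to about \<open>\<surd>l\<close> values. The proportion of matrices that
  are not generic is thus of order \<open>1 / \<surd>l\<close> (\<open>card_not_generic_le_classes\<close>).
\<close>

section \<open>Edge cells and contingency matrices\<close>

text \<open>
  A labelling of both colour classes by \<open>0, \<dots>, k - 1\<close> together with the position of each edge in the
  resulting matrix. The incidence relation is thereby replaced by the function \<open>c\<close>, whose fibres are
  the bundles of parallel edges.
\<close>

definition coordinates ::
  "nat \<Rightarrow> ('v, 'e) cgraph \<Rightarrow> (nat \<Rightarrow> 'v) \<Rightarrow> (nat \<Rightarrow> 'v) \<Rightarrow> ('e \<Rightarrow> nat \<times> nat) \<Rightarrow> bool" where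
  "coordinates k \<Gamma> b w c \<longleftrightarrow>
     bij_betw b {..<k} {v \<in> verts \<Gamma>. colour \<Gamma> v = Black} \<and>
     bij_betw w {..<k} {v \<in> verts \<Gamma>. colour \<Gamma> v = White} \<and>
     c \<in> edges \<Gamma> \<rightarrow> {..<k} \<times> {..<k} \<and>
     (\<forall>e\<in>edges \<Gamma>. \<forall>i<k. ((b i, e) \<in> inc \<Gamma> \<longleftrightarrow> i = fst (c e)) \<and>
                         ((w i, e) \<in> inc \<Gamma> \<longleftrightarrow> i = snd (c e)))"

text \<open>
  For the edge set and the third component of \<open>coordinates\<close> this is the bipartite adjacency matrix,
  with multiplicities and with the value \<open>0\<close> outside the \<open>k \<times> k\<close> square.
\<close>

definition fibre_card :: "'e set \<Rightarrow> ('e \<Rightarrow> 'i) \<Rightarrow> 'i \<Rightarrow> nat" where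
  "fibre_card E c p = card {e \<in> E. c e = p}"

text \<open>
  Requiring \<open>0\<close> outside the square makes each matrix a unique function, so that \<open>card\<close> counts
  matrices.
\<close>

definition contingency :: "nat \<Rightarrow> nat \<Rightarrow> (nat \<times> nat \<Rightarrow> nat) set" where
  "contingency k l = {A. (\<forall>p. p \<notin> {..<k} \<times> {..<k} \<longrightarrow> A p = 0) \<and>
     (\<forall>i<k. (\<Sum>j<k. A (i, j)) = l) \<and> (\<forall>j<k. (\<Sum>i<k. A (i, j)) = l)}"

lemma coordinatesD:
  assumes "coordinates k \<Gamma> b w c"
  shows "inj_on b {..<k}" "inj_on w {..<k}"
    and "i < k \<Longrightarrow> b i \<in> verts \<Gamma> \<and> colour \<Gamma> (b i) = Black"
    and "i < k \<Longrightarrow> w i \<in> verts \<Gamma> \<and> colour \<Gamma> (w i) = White"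
    and "e \<in> edges \<Gamma> \<Longrightarrow> fst (c e) < k" "e \<in> edges \<Gamma> \<Longrightarrow> snd (c e) < k"
    and "e \<in> edges \<Gamma> \<Longrightarrow> i < k \<Longrightarrow> (b i, e) \<in> inc \<Gamma> \<longleftrightarrow> i = fst (c e)"
    and "e \<in> edges \<Gamma> \<Longrightarrow> i < k \<Longrightarrow> (w i, e) \<in> inc \<Gamma> \<longleftrightarrow> i = snd (c e)"
  using assms unfolding coordinates_def bij_betw_def
  by (auto dest!: PiE simp: Pi_iff mem_Times_iff)

lemma vertex_cases:
  assumes "coordinates k \<Gamma> b w c" "v \<in> verts \<Gamma>"
  obtains (Black) i where "i < k" "v = b i" | (White) j where "j < k" "v = w j"
proof (cases "colour \<Gamma> v")
  case Black
  then have "v \<in> b ` {..<k}" using assms unfolding coordinates_def bij_betw_def by auto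
  then show ?thesis using that(1) by blast
next
  case White
  then have "v \<in> w ` {..<k}" using assms unfolding coordinates_def bij_betw_def by auto
  then show ?thesis using that(2) by blast
qed

text \<open>
  The two ends of an edge have different colours, so exactly one is black and one is white; their
  labels are the coordinates of the edge.
\<close>

lemma exists_coordinates:
  assumes "kl_bipartite k l \<Gamma>"
  obtains b w c where "coordinates k \<Gamma> b w c"
proof -
  let ?B = "{v \<in> verts \<Gamma>. colour \<Gamma> v = Black}" and ?W = "{v \<in> verts \<Gamma>. colour \<Gamma> v = White}"
  have fin: "finite ?B" "finite ?W" and card: "card ?B = k" "card ?W = k"
    and mg: "multigraph \<Gamma>" and bic: "bicoloured \<Gamma>"
    using assms unfolding kl_bipartite_def by auto
  obtain b where b: "bij_betw b {..<k} ?B"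
    using finite_same_card_bij[of "{..<k}" ?B] fin card by auto
  obtain w where w: "bij_betw w {..<k} ?W"
    using finite_same_card_bij[of "{..<k}" ?W] fin card by auto
  have "\<exists>p\<in>{..<k} \<times> {..<k}. \<forall>i<k. ((b i, e) \<in> inc \<Gamma> \<longleftrightarrow> i = fst p) \<and>
          ((w i, e) \<in> inc \<Gamma> \<longleftrightarrow> i = snd p)" if e: "e \<in> edges \<Gamma>" for e
  proof -
    have "card {v \<in> verts \<Gamma>. (v, e) \<in> inc \<Gamma>} = 2" using mg e unfolding multigraph_def by auto
    then obtain x y where xy: "{v \<in> verts \<Gamma>. (v, e) \<in> inc \<Gamma>} = {x, y}" "x \<noteq> y"
      unfolding card_2_iff by blast
    then have "(x, e) \<in> inc \<Gamma>" "(y, e) \<in> inc \<Gamma>" by auto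
    then have "colour \<Gamma> x \<noteq> colour \<Gamma> y" using bic xy(2) unfolding bicoloured_def by blast
    then obtain u v where uv: "{v \<in> verts \<Gamma>. (v, e) \<in> inc \<Gamma>} = {u, v}"
      "colour \<Gamma> u = Black" "colour \<Gamma> v = White"
      using xy(1) insert_commute[of x y "{}"] by (cases "colour \<Gamma> x"; cases "colour \<Gamma> y") auto
    have "u \<in> b ` {..<k}" "v \<in> w ` {..<k}" using uv b w unfolding bij_betw_def by auto
    then obtain i j where ij: "i < k" "u = b i" "j < k" "v = w j" by auto
    have vb: "b i' \<in> ?B" "w i' \<in> ?W" if "i' < k" for i'
      using b w that unfolding bij_betw_def by auto
    have "(b i', e) \<in> inc \<Gamma> \<longleftrightarrow> i' = i" if "i' < k" for i'
    proof -
      have "(b i', e) \<in> inc \<Gamma> \<longleftrightarrow> b i' \<in> {u, v}" using vb[OF that] uv(1) by auto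
      also have "\<dots> \<longleftrightarrow> b i' = b i" using vb[OF that] uv(2,3) ij by auto
      also have "\<dots> \<longleftrightarrow> i' = i" using b that ij(1) unfolding bij_betw_def inj_on_def by auto
      finally show ?thesis .
    qed
    moreover have "(w i', e) \<in> inc \<Gamma> \<longleftrightarrow> i' = j" if "i' < k" for i'
    proof -
      have "(w i', e) \<in> inc \<Gamma> \<longleftrightarrow> w i' \<in> {u, v}" using vb[OF that] uv(1) by auto
      also have "\<dots> \<longleftrightarrow> w i' = w j" using vb[OF that] uv(2,3) ij by auto
      also have "\<dots> \<longleftrightarrow> i' = j" using w that ij(3) unfolding bij_betw_def inj_on_def by auto
      finally show ?thesis .
    qed
    ultimately show ?thesis using ij by (intro bexI[of _ "(i, j)"]) auto
  qed
  then obtain c where "\<forall>e\<in>edges \<Gamma>. c e \<in> {..<k} \<times> {..<k} \<and>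
      (\<forall>i<k. ((b i, e) \<in> inc \<Gamma> \<longleftrightarrow> i = fst (c e)) \<and> ((w i, e) \<in> inc \<Gamma> \<longleftrightarrow> i = snd (c e)))"
    by metis
  then have "coordinates k \<Gamma> b w c" using b w unfolding coordinates_def by blast
  then show ?thesis by (rule that)
qed

lemma fibre_card_row:
  assumes "finite E" "c \<in> E \<rightarrow> {..<k::nat} \<times> {..<k::nat}"
  shows "(\<Sum>j<k. fibre_card E c (i, j)) = card {e \<in> E. fst (c e) = i}"
proof -
  have "{e \<in> E. fst (c e) = i} = (\<Union>j<k. {e \<in> E. c e = (i, j)})"
    using assms(2) by (auto simp: Pi_iff mem_Times_iff)
  also have "card \<dots> = (\<Sum>j<k. card {e \<in> E. c e = (i, j)})"
    using assms(1) by (intro card_UN_disjoint) auto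
  finally show ?thesis by (simp add: fibre_card_def)
qed

lemma fibre_card_column:
  assumes "finite E" "c \<in> E \<rightarrow> {..<k::nat} \<times> {..<k::nat}"
  shows "(\<Sum>i<k. fibre_card E c (i, j)) = card {e \<in> E. snd (c e) = j}"
proof -
  have "{e \<in> E. snd (c e) = j} = (\<Union>i<k. {e \<in> E. c e = (i, j)})"
    using assms(2) by (auto simp: Pi_iff mem_Times_iff)
  also have "card \<dots> = (\<Sum>i<k. card {e \<in> E. c e = (i, j)})"
    using assms(1) by (intro card_UN_disjoint) auto
  finally show ?thesis by (simp add: fibre_card_def)
qed

lemma fibre_card_outside:
  assumes "c \<in> E \<rightarrow> I" "p \<notin> I"
  shows "fibre_card E c p = 0"
proof -
  have "{e \<in> E. c e = p} = {}" using assms by auto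
  then show ?thesis unfolding fibre_card_def by (simp only: card.empty)
qed

lemma fibre_card_in_contingency:
  assumes co: "coordinates k \<Gamma> b w c" and fin: "finite (edges \<Gamma>)" and reg: "regular l \<Gamma>"
  shows "fibre_card (edges \<Gamma>) c \<in> contingency k l"
proof -
  have c: "c \<in> edges \<Gamma> \<rightarrow> {..<k} \<times> {..<k}" using co unfolding coordinates_def by simp
  have "card {e \<in> edges \<Gamma>. fst (c e) = i} = l" if "i < k" for i
  proof -
    have "{e \<in> edges \<Gamma>. fst (c e) = i} = {e \<in> edges \<Gamma>. (b i, e) \<in> inc \<Gamma>}"
      using coordinatesD(7)[OF co] that by auto
    then show ?thesis using reg coordinatesD(3)[OF co that] unfolding regular_def by simp
  qed
  moreover have "card {e \<in> edges \<Gamma>. snd (c e) = i} = l" if "i < k" for i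
  proof -
    have "{e \<in> edges \<Gamma>. snd (c e) = i} = {e \<in> edges \<Gamma>. (w i, e) \<in> inc \<Gamma>}"
      using coordinatesD(8)[OF co] that by auto
    then show ?thesis using reg coordinatesD(4)[OF co that] unfolding regular_def by simp
  qed
  ultimately show ?thesis
    unfolding contingency_def
    using fibre_card_row[OF fin c] fibre_card_column[OF fin c] fibre_card_outside[OF c] by simp
qed

text \<open>
  Coordinates force every edge to have one end of each colour, and the degrees of the vertices are
  the row and column sums of the matrix.
\<close>

lemma coordinates_kl_bipartite:
  assumes co: "coordinates k \<Gamma> b w c" and fin: "finite (verts \<Gamma>)" "finite (edges \<Gamma>)"
    and inc: "inc \<Gamma> \<subseteq> verts \<Gamma> \<times> edges \<Gamma>"
    and A: "fibre_card (edges \<Gamma>) c \<in> contingency k l"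
  shows "kl_bipartite k l \<Gamma>"
proof -
  note cD = coordinatesD[OF co]
  have c: "c \<in> edges \<Gamma> \<rightarrow> {..<k} \<times> {..<k}" using co unfolding coordinates_def by simp
  have bw: "b i \<noteq> w j" if "i < k" "j < k" for i j
    using cD(3)[OF that(1)] cD(4)[OF that(2)] by auto
  have "multigraph \<Gamma>"
    unfolding multigraph_def
  proof (intro conjI ballI)
    fix e assume e: "e \<in> edges \<Gamma>"
    have "{v \<in> verts \<Gamma>. (v, e) \<in> inc \<Gamma>} = {b (fst (c e)), w (snd (c e))}"
    proof (intro set_eqI iffI)
      fix v assume "v \<in> {v \<in> verts \<Gamma>. (v, e) \<in> inc \<Gamma>}"
      then have v: "v \<in> verts \<Gamma>" "(v, e) \<in> inc \<Gamma>" by auto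
      from co v(1) show "v \<in> {b (fst (c e)), w (snd (c e))}"
        by (cases rule: vertex_cases) (use v(2) cD(7,8)[OF e] in auto)
    qed (use cD(3-8) e in auto)
    then show "card {v \<in> verts \<Gamma>. (v, e) \<in> inc \<Gamma>} = 2" using bw cD(5,6)[OF e] by simp
  qed (rule inc)
  moreover have "bicoloured \<Gamma>"
    unfolding bicoloured_def
  proof (intro allI impI)
    fix e u v assume i: "(u, e) \<in> inc \<Gamma>" "(v, e) \<in> inc \<Gamma>" "u \<noteq> v"
    then have m: "u \<in> verts \<Gamma>" "v \<in> verts \<Gamma>" and e: "e \<in> edges \<Gamma>" using inc by auto
    from co m(1) show "colour \<Gamma> u \<noteq> colour \<Gamma> v"
    proof (cases rule: vertex_cases)
      case u: (Black i)
      from co m(2) show ?thesis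
        by (cases rule: vertex_cases) (use u i cD(3,4,7)[of] e in auto)
    next
      case u: (White i)
      from co m(2) show ?thesis
        by (cases rule: vertex_cases) (use u i cD(3,4,8)[of] e in auto)
    qed
  qed
  moreover have "regular l \<Gamma>"
    unfolding regular_def
  proof
    fix v assume "v \<in> verts \<Gamma>"
    with co show "card {e \<in> edges \<Gamma>. (v, e) \<in> inc \<Gamma>} = l"
    proof (cases rule: vertex_cases)
      case (Black i)
      then have "{e \<in> edges \<Gamma>. (v, e) \<in> inc \<Gamma>} = {e \<in> edges \<Gamma>. fst (c e) = i}"
        using cD(7) by auto
      then show ?thesis
        using fibre_card_row[OF fin(2) c, of i] A Black(1) unfolding contingency_def by simp
    next
      case (White j)
      then have "{e \<in> edges \<Gamma>. (v, e) \<in> inc \<Gamma>} = {e \<in> edges \<Gamma>. snd (c e) = j}"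
        using cD(8) by auto
      then show ?thesis
        using fibre_card_column[OF fin(2) c, of j] A White(1) unfolding contingency_def by simp
    qed
  qed
  moreover have "card {v \<in> verts \<Gamma>. colour \<Gamma> v = Black} = k"
    "card {v \<in> verts \<Gamma>. colour \<Gamma> v = White} = k"
    using co bij_betw_same_card unfolding coordinates_def by fastforce+
  ultimately show ?thesis using fin unfolding kl_bipartite_def by simp
qed

text \<open>
  The edges are the pairs of a position \<open>p\<close> and a number below \<open>A p\<close>, renumbered by an initial segment
  of the natural numbers.
\<close>

lemma contingency_realised:
  assumes A: "A \<in> contingency k l"
  obtains \<Gamma> :: "(nat, nat) cgraph" and b w c
  where "kl_bipartite k l \<Gamma>" "coordinates k \<Gamma> b w c" "fibre_card (edges \<Gamma>) c = A"
proof -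
  let ?S = "Sigma ({..<k} \<times> {..<k}) (\<lambda>p. {..<A p})"
  obtain f where f: "bij_betw f {..<card ?S} ?S"
    using finite_same_card_bij[of "{..<card ?S}" ?S] by auto
  define c where "c = fst \<circ> f"
  define \<Gamma> :: "(nat, nat) cgraph" where
    "\<Gamma> = \<lparr>verts = {..<k + k}, edges = {..<card ?S},
          inc = {(v, e). e < card ?S \<and> (v = fst (c e) \<or> v = k + snd (c e))},
          colour = (\<lambda>v. if v < k then Black else White)\<rparr>"
  have fS: "f e \<in> ?S" if "e < card ?S" for e using f that by (auto dest: bij_betwE)
  have c: "c e \<in> {..<k} \<times> {..<k}" if "e < card ?S" for e
    using fS[OF that] by (auto simp: c_def)
  then have c': "fst (c e) < k \<and> snd (c e) < k" if "e < card ?S" for e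
    using that by (auto simp: mem_Times_iff)
  have "{v \<in> verts \<Gamma>. colour \<Gamma> v = White} = {k..<k + k}" by (auto simp: \<Gamma>_def)
  moreover have "(\<lambda>j. k + j) ` {..<k} = {k..<k + k}"
    using image_add_atLeastLessThan[of k 0 k] by (simp add: atLeast0LessThan)
  ultimately have "bij_betw (\<lambda>j. k + j) {..<k} {v \<in> verts \<Gamma>. colour \<Gamma> v = White}"
    by (simp add: bij_betw_def)
  moreover have "{v \<in> verts \<Gamma>. colour \<Gamma> v = Black} = {..<k}" by (auto simp: \<Gamma>_def)
  ultimately have co: "coordinates k \<Gamma> id (\<lambda>j. k + j) c"
    unfolding coordinates_def using c c' by (auto simp: \<Gamma>_def)
  have "fibre_card (edges \<Gamma>) c p = A p" for p
  proof (cases "p \<in> {..<k} \<times> {..<k}")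
    case True
    have "f ` {e \<in> edges \<Gamma>. c e = p} = {x \<in> ?S. fst x = p}"
    proof (intro set_eqI iffI)
      fix x assume x: "x \<in> {x \<in> ?S. fst x = p}"
      then obtain e where "e < card ?S" "f e = x"
        using f unfolding bij_betw_def by (metis (no_types, lifting) imageE lessThan_iff mem_Collect_eq)
      then show "x \<in> f ` {e \<in> edges \<Gamma>. c e = p}" using x by (auto simp: \<Gamma>_def c_def)
    next
      fix x assume "x \<in> f ` {e \<in> edges \<Gamma>. c e = p}"
      then obtain e where "e < card ?S" "x = f e" "fst (f e) = p" by (auto simp: \<Gamma>_def c_def)
      then show "x \<in> {x \<in> ?S. fst x = p}" using fS[of e] by simp
    qed
    also have "\<dots> = Pair p ` {..<A p}" using True by auto
    finally have "card (f ` {e \<in> edges \<Gamma>. c e = p}) = A p"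
      by (simp add: card_image inj_on_def)
    moreover have "inj_on f {e \<in> edges \<Gamma>. c e = p}"
      using f unfolding bij_betw_def \<Gamma>_def by (auto elim: inj_on_subset)
    ultimately show ?thesis by (simp add: fibre_card_def card_image)
  next
    case False
    moreover have "c \<in> edges \<Gamma> \<rightarrow> {..<k} \<times> {..<k}" using co unfolding coordinates_def by simp
    ultimately have "fibre_card (edges \<Gamma>) c p = 0" by (intro fibre_card_outside)
    moreover have "A p = 0" using A False unfolding contingency_def by blast
    ultimately show ?thesis by simp
  qed
  then have eq: "fibre_card (edges \<Gamma>) c = A" by blast
  have "inc \<Gamma> \<subseteq> verts \<Gamma> \<times> edges \<Gamma>" using c' by (auto simp: \<Gamma>_def trans_less_add1)
  then have "kl_bipartite k l \<Gamma>"
    using coordinates_kl_bipartite[OF co] A eq by (simp add: \<Gamma>_def)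
  then show ?thesis using co eq by (rule that)
qed

section \<open>Isomorphism in terms of matrices\<close>

text \<open>
  Bijections between corresponding fibres are glued to one bijection that respects the fibrations.
\<close>

lemma bij_betw_matching_fibres:
  assumes fin: "finite E" "finite F" and eq: "fibre_card E c = fibre_card F d"
  obtains \<psi> where "bij_betw \<psi> E F" "\<And>e. e \<in> E \<Longrightarrow> d (\<psi> e) = c e"
proof -
  have "\<exists>f. bij_betw f {e \<in> E. c e = p} {e \<in> F. d e = p}" for p
    by (rule finite_same_card_bij) (use fin fun_cong[OF eq, of p] in \<open>auto simp: fibre_card_def\<close>)
  then obtain f where f: "\<And>p. bij_betw (f p) {e \<in> E. c e = p} {e \<in> F. d e = p}" by metis
  define \<psi> where "\<psi> e = f (c e) e" for e
  have \<psi>: "\<psi> e \<in> F \<and> d (\<psi> e) = c e" if "e \<in> E" for e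
    using bij_betwE[OF f[of "c e"]] that by (auto simp: \<psi>_def)
  have "inj_on \<psi> E"
  proof (rule inj_onI)
    fix x y assume xy: "x \<in> E" "y \<in> E" "\<psi> x = \<psi> y"
    then have "c x = c y" using \<psi> by metis
    then show "x = y" using f[of "c x"] xy unfolding bij_betw_def inj_on_def \<psi>_def by auto
  qed
  moreover have "F \<subseteq> \<psi> ` E"
  proof
    fix y assume "y \<in> F"
    then have "y \<in> f (d y) ` {e \<in> E. c e = d y}" using f[of "d y"] unfolding bij_betw_def by auto
    then obtain e where "e \<in> E" "c e = d y" "y = f (d y) e" by blast
    then show "y \<in> \<psi> ` E" by (intro image_eqI[of _ _ e]) (simp_all add: \<psi>_def)
  qed
  ultimately have "bij_betw \<psi> E F" using \<psi> unfolding bij_betw_def by auto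
  then show ?thesis using \<psi> that by blast
qed

text \<open>
  The matrix is a complete invariant: vertices are matched by their labels, and the bundles of
  parallel edges, having equal sizes, are matched arbitrarily.
\<close>

lemma isomorphic_of_same_matrix:
  assumes co: "coordinates k \<Gamma> b w c" and co': "coordinates k \<Delta> b' w' c'"
    and fin: "finite (edges \<Gamma>)" "finite (edges \<Delta>)"
    and eq: "fibre_card (edges \<Gamma>) c = fibre_card (edges \<Delta>) c'"
  shows "isomorphic \<Gamma> \<Delta>"
proof -
  note cD = coordinatesD[OF co] and cD' = coordinatesD[OF co']
  obtain \<psi> where \<psi>: "bij_betw \<psi> (edges \<Gamma>) (edges \<Delta>)" "\<And>e. e \<in> edges \<Gamma> \<Longrightarrow> c' (\<psi> e) = c e"
    using bij_betw_matching_fibres[OF fin eq] by blast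
  define \<phi> where "\<phi> v = (if colour \<Gamma> v = Black then b' (inv_into {..<k} b v)
                          else w' (inv_into {..<k} w v))" for v
  have \<phi>: "\<phi> (b i) = b' i" "\<phi> (w i) = w' i" if "i < k" for i
    using that cD(1-4) by (auto simp: \<phi>_def)
  have "bij_betw \<phi> (verts \<Gamma>) (verts \<Delta>)"
    unfolding bij_betw_def
  proof
    show "inj_on \<phi> (verts \<Gamma>)"
    proof (rule inj_onI)
      fix x y assume xy: "x \<in> verts \<Gamma>" "y \<in> verts \<Gamma>" "\<phi> x = \<phi> y"
      have ne: "b' i \<noteq> w' j" if "i < k" "j < k" for i j
        using cD'(3)[OF that(1)] cD'(4)[OF that(2)] by auto
      from co xy(1) show "x = y"
      proof (cases rule: vertex_cases)
        case x: (Black i)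
        from co xy(2) show ?thesis
          by (cases rule: vertex_cases) (use x xy(3) \<phi> ne inj_on_eq_iff[OF cD'(1)] in auto)
      next
        case x: (White i)
        from co xy(2) show ?thesis
          by (cases rule: vertex_cases) (use x xy(3) \<phi> ne[symmetric] inj_on_eq_iff[OF cD'(2)] in auto)
      qed
    qed
    show "\<phi> ` verts \<Gamma> = verts \<Delta>"
    proof (intro equalityI subsetI)
      fix y assume "y \<in> \<phi> ` verts \<Gamma>"
      then obtain x where x: "x \<in> verts \<Gamma>" "y = \<phi> x" by blast
      from co x(1) show "y \<in> verts \<Delta>"
        by (cases rule: vertex_cases) (use x \<phi> cD'(3,4) in auto)
    next
      fix y assume "y \<in> verts \<Delta>"
      with co' show "y \<in> \<phi> ` verts \<Gamma>"
        by (cases rule: vertex_cases) (use \<phi>[symmetric] cD(3,4) in auto)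
    qed
  qed
  moreover have "colour \<Delta> (\<phi> v) = colour \<Gamma> v" if "v \<in> verts \<Gamma>" for v
    using co that by (cases rule: vertex_cases) (use \<phi> cD(3,4) cD'(3,4) in auto)
  moreover have "(v, e) \<in> inc \<Gamma> \<longleftrightarrow> (\<phi> v, \<psi> e) \<in> inc \<Delta>"
    if "v \<in> verts \<Gamma>" and e: "e \<in> edges \<Gamma>" for v e
  proof -
    have pe: "\<psi> e \<in> edges \<Delta>" using \<psi>(1) e by (auto dest: bij_betwE)
    from co that(1) show ?thesis
      by (cases rule: vertex_cases) (use \<phi> \<psi>(2)[OF e] cD(7,8)[OF e] cD'(7,8)[OF pe] in auto)
  qed
  ultimately show ?thesis using \<psi>(1) unfolding isomorphic_def is_iso_def by blast
qed

text \<open>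
  Carrying labels along an isomorphism does not change the matrix. For an automorphism this gives a
  second labelling of the same graph with the same matrix.
\<close>

lemma coordinates_transport:
  assumes co: "coordinates k \<Gamma> b w c" and iso: "is_iso \<Gamma> \<Delta> \<phi> \<psi>"
  defines "c' \<equiv> c \<circ> inv_into (edges \<Gamma>) \<psi>"
  shows "coordinates k \<Delta> (\<phi> \<circ> b) (\<phi> \<circ> w) c'"
    and "fibre_card (edges \<Delta>) c' = fibre_card (edges \<Gamma>) c"
proof -
  note cD = coordinatesD[OF co]
  have \<phi>: "bij_betw \<phi> (verts \<Gamma>) (verts \<Delta>)" and \<psi>: "bij_betw \<psi> (edges \<Gamma>) (edges \<Delta>)"
    and col: "\<And>v. v \<in> verts \<Gamma> \<Longrightarrow> colour \<Delta> (\<phi> v) = colour \<Gamma> v"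
    and inc: "\<And>v e. v \<in> verts \<Gamma> \<Longrightarrow> e \<in> edges \<Gamma> \<Longrightarrow> (v, e) \<in> inc \<Gamma> \<longleftrightarrow> (\<phi> v, \<psi> e) \<in> inc \<Delta>"
    using iso unfolding is_iso_def by auto
  have col_bij: "bij_betw \<phi> {v \<in> verts \<Gamma>. colour \<Gamma> v = x} {v \<in> verts \<Delta>. colour \<Delta> v = x}" for x
  proof (rule bij_betw_subset[OF \<phi>])
    show "\<phi> ` {v \<in> verts \<Gamma>. colour \<Gamma> v = x} = {v \<in> verts \<Delta>. colour \<Delta> v = x}"
    proof (intro equalityI subsetI)
      fix y assume "y \<in> {v \<in> verts \<Delta>. colour \<Delta> v = x}"
      moreover from this obtain v where "v \<in> verts \<Gamma>" "y = \<phi> v"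
        using \<phi> unfolding bij_betw_def by auto
      ultimately show "y \<in> \<phi> ` {v \<in> verts \<Gamma>. colour \<Gamma> v = x}" using col by auto
    qed (use col bij_betwE[OF \<phi>] in auto)
  qed auto
  define \<theta> where "\<theta> = inv_into (edges \<Gamma>) \<psi>"
  have \<theta>: "\<theta> f \<in> edges \<Gamma> \<and> \<psi> (\<theta> f) = f" if "f \<in> edges \<Delta>" for f
    using \<psi> that unfolding \<theta>_def by (metis bij_betw_def f_inv_into_f inv_into_into)
  have "bij_betw (\<phi> \<circ> b) {..<k} {v \<in> verts \<Delta>. colour \<Delta> v = Black}"
    "bij_betw (\<phi> \<circ> w) {..<k} {v \<in> verts \<Delta>. colour \<Delta> v = White}"
    using co col_bij unfolding coordinates_def by (auto intro: bij_betw_trans)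
  moreover have "c' \<in> edges \<Delta> \<rightarrow> {..<k} \<times> {..<k}"
    using \<theta> cD(5,6) unfolding c'_def \<theta>_def[symmetric] by (auto simp: mem_Times_iff)
  moreover have "(\<phi> (b i), f) \<in> inc \<Delta> \<longleftrightarrow> i = fst (c' f)" "(\<phi> (w i), f) \<in> inc \<Delta> \<longleftrightarrow> i = snd (c' f)"
    if "f \<in> edges \<Delta>" "i < k" for f i
    using inc[of "b i" "\<theta> f"] inc[of "w i" "\<theta> f"] \<theta>[OF that(1)] that(2) cD(3,4,7,8)
    unfolding c'_def \<theta>_def[symmetric] by auto
  ultimately show "coordinates k \<Delta> (\<phi> \<circ> b) (\<phi> \<circ> w) c'"
    unfolding coordinates_def by simp
  show "fibre_card (edges \<Delta>) c' = fibre_card (edges \<Gamma>) c"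
  proof
    fix p
    have bij: "bij_betw \<theta> (edges \<Delta>) (edges \<Gamma>)"
      unfolding \<theta>_def by (rule bij_betw_inv_into[OF \<psi>])
    then have "\<theta> ` {f \<in> edges \<Delta>. c' f = p} = {e \<in> edges \<Gamma>. c e = p}"
      unfolding c'_def \<theta>_def[symmetric] bij_betw_def by auto
    then have "bij_betw \<theta> {f \<in> edges \<Delta>. c' f = p} {e \<in> edges \<Gamma>. c e = p}"
      by (intro bij_betw_subset[OF bij]) auto
    then show "fibre_card (edges \<Delta>) c' p = fibre_card (edges \<Gamma>) c p"
      unfolding fibre_card_def by (rule bij_betw_same_card)
  qed
qed

lemma relabelling:
  assumes "bij_betw b {..<k} X" "bij_betw b' {..<k} X"
  obtains \<sigma> where "\<sigma> permutes {..<k::nat}" "\<And>i. i < k \<Longrightarrow> b' i = b (\<sigma> i)"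
proof -
  define \<sigma> where "\<sigma> i = (if i \<in> {..<k} then inv_into {..<k} b (b' i) else i)" for i
  have "bij_betw (inv_into {..<k} b \<circ> b') {..<k} {..<k}"
    using assms by (meson bij_betw_inv_into bij_betw_trans)
  then have "bij_betw \<sigma> {..<k} {..<k}"
    by (rule bij_betw_cong[THEN iffD1, rotated]) (simp add: \<sigma>_def)
  then have "\<sigma> permutes {..<k}" by (rule bij_imp_permutes) (simp add: \<sigma>_def)
  moreover have "b' i = b (\<sigma> i)" if "i < k" for i
  proof -
    have "b' i \<in> b ` {..<k}" using assms that unfolding bij_betw_def by auto
    then show ?thesis using that by (simp add: \<sigma>_def f_inv_into_f)
  qed
  ultimately show ?thesis by (rule that)
qed

text \<open>
  Two labellings of one graph differ by a permutation of each colour class, and their matrices by the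
  corresponding permutations of the rows and of the columns.
\<close>

lemma change_of_coordinates:
  assumes co: "coordinates k \<Gamma> b w c" and co': "coordinates k \<Gamma> b' w' c'"
  obtains \<sigma> \<tau> where "\<sigma> permutes {..<k}" "\<tau> permutes {..<k}"
    "\<And>i. i < k \<Longrightarrow> b' i = b (\<sigma> i)" "\<And>j. j < k \<Longrightarrow> w' j = w (\<tau> j)"
    "fibre_card (edges \<Gamma>) c' = fibre_card (edges \<Gamma>) c \<circ> map_prod \<sigma> \<tau>"
proof -
  note cD = coordinatesD[OF co] and cD' = coordinatesD[OF co']
  obtain \<sigma> where s: "\<sigma> permutes {..<k}" "\<And>i. i < k \<Longrightarrow> b' i = b (\<sigma> i)"
    using co co' unfolding coordinates_def by (auto elim: relabelling)
  obtain \<tau> where t: "\<tau> permutes {..<k}" "\<And>i. i < k \<Longrightarrow> w' i = w (\<tau> i)"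
    using co co' unfolding coordinates_def by (auto elim: relabelling)
  have c: "c e = map_prod \<sigma> \<tau> (c' e)" if e: "e \<in> edges \<Gamma>" for e
  proof -
    have "\<sigma> (fst (c' e)) < k" "\<tau> (snd (c' e)) < k"
      using permutes_in_image[OF s(1)] permutes_in_image[OF t(1)] cD'(5,6)[OF e] by auto
    then have "\<sigma> (fst (c' e)) = fst (c e)" "\<tau> (snd (c' e)) = snd (c e)"
      using cD(7,8)[OF e] cD'(7)[OF e cD'(5)[OF e]] cD'(8)[OF e cD'(6)[OF e]]
        s(2)[OF cD'(5)[OF e]] t(2)[OF cD'(6)[OF e]] by auto
    then show ?thesis by (simp add: prod_eq_iff)
  qed
  have "inj (map_prod \<sigma> \<tau>)"
    using permutes_inj[OF s(1)] permutes_inj[OF t(1)] by (rule prod.inj_map)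
  then have "{e \<in> edges \<Gamma>. c' e = p} = {e \<in> edges \<Gamma>. c e = map_prod \<sigma> \<tau> p}" for p
    using c by (auto dest: injD)
  then have "fibre_card (edges \<Gamma>) c' = fibre_card (edges \<Gamma>) c \<circ> map_prod \<sigma> \<tau>"
    by (auto simp: fibre_card_def)
  then show ?thesis using s t that by blast
qed

section \<open>Automorphisms in terms of matrices\<close>

text \<open>
  Transporting the labelling along the automorphism leaves the matrix unchanged but permutes its rows
  and columns, by \<open>\<sigma>\<close> and \<open>\<tau>\<close> say. The entries at \<open>(i, j)\<close> and \<open>(\<sigma> i, \<tau> j)\<close> are then equal, and
  distinctness of the entries makes these positions equal.
\<close>

lemma Aut_fixes_vertices:
  assumes co: "coordinates k \<Gamma> b w c" and aut: "(\<phi>, \<psi>) \<in> Aut \<Gamma>" and v: "v \<in> verts \<Gamma>"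
    and inj: "inj_on (fibre_card (edges \<Gamma>) c) ({..<k} \<times> {..<k})"
  shows "\<phi> v = v"
proof -
  have "is_iso \<Gamma> \<Gamma> \<phi> \<psi>" using aut unfolding Aut_def by simp
  note tr = coordinates_transport[OF co this]
  obtain \<sigma> \<tau> where st: "\<sigma> permutes {..<k}" "\<tau> permutes {..<k}"
    and eq: "\<And>i. i < k \<Longrightarrow> (\<phi> \<circ> b) i = b (\<sigma> i)" "\<And>j. j < k \<Longrightarrow> (\<phi> \<circ> w) j = w (\<tau> j)"
    and A: "fibre_card (edges \<Gamma>) c = fibre_card (edges \<Gamma>) c \<circ> map_prod \<sigma> \<tau>"
    using change_of_coordinates[OF co tr(1)] unfolding tr(2) by blast
  have "(\<sigma> i, \<tau> j) = (i, j)" if "i < k" "j < k" for i j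
  proof (rule inj_onD[OF inj])
    show "fibre_card (edges \<Gamma>) c (\<sigma> i, \<tau> j) = fibre_card (edges \<Gamma>) c (i, j)"
      using fun_cong[OF A, of "(i, j)"] by simp
  qed (use that permutes_in_image[OF st(1)] permutes_in_image[OF st(2)] in auto)
  then have "\<sigma> i = i" "\<tau> i = i" if "i < k" for i using that by auto
  with co v show ?thesis by (cases rule: vertex_cases) (use eq in auto)
qed

text \<open>
  Such a permutation is determined by its restrictions to the fibres, each of which is a permutation
  of the fibre.
\<close>

lemma card_fibre_preserving_permutations:
  assumes fin: "finite E" "finite I" and c: "c \<in> E \<rightarrow> I"
  defines "S \<equiv> {\<theta>. \<theta> permutes E \<and> (\<forall>e\<in>E. c (\<theta> e) = c e)}"
  shows "finite S" and "card S \<le> (\<Prod>p\<in>I. fact (fibre_card E c p))"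
proof -
  have "S \<subseteq> {\<theta>. \<theta> permutes E}" unfolding S_def by auto
  then show "finite S" using finite_permutations[OF fin(1)] by (rule finite_subset)
  define F where "F p = {e \<in> E. c e = p}" for p
  define R where "R \<theta> = (\<lambda>p\<in>I. \<lambda>e. if e \<in> F p then \<theta> e else e)" for \<theta> :: "'a \<Rightarrow> 'a"
  have finF: "finite (F p)" for p using fin(1) unfolding F_def by auto
  have "inj_on R S"
  proof (rule inj_onI)
    fix \<theta> \<theta>' assume S: "\<theta> \<in> S" "\<theta>' \<in> S" and R: "R \<theta> = R \<theta>'"
    show "\<theta> = \<theta>'"
    proof
      fix e show "\<theta> e = \<theta>' e"
      proof (cases "e \<in> E")
        case True
        then have "c e \<in> I" "e \<in> F (c e)" using c by (auto simp: F_def)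
        then show ?thesis using fun_cong[OF fun_cong[OF R, of "c e"], of e] by (simp add: R_def)
      next
        case False
        then show ?thesis using S unfolding S_def permutes_def by simp
      qed
    qed
  qed
  moreover have "R ` S \<subseteq> PiE I (\<lambda>p. {\<pi>. \<pi> permutes F p})"
  proof (intro image_subsetI PiE_I)
    fix \<theta> p assume \<theta>: "\<theta> \<in> S"
    then have perm: "\<theta> permutes E" and pres: "\<And>e. e \<in> E \<Longrightarrow> c (\<theta> e) = c e"
      unfolding S_def by auto
    assume "p \<in> I"
    have "\<theta> ` F p \<subseteq> F p"
      using pres permutes_in_image[OF perm] unfolding F_def by auto
    moreover have "inj_on \<theta> (F p)"
      using permutes_inj[OF perm] by (rule inj_on_subset) simp
    ultimately have "bij_betw \<theta> (F p) (F p)"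
      using endo_inj_surj[OF finF] unfolding bij_betw_def by auto
    then have "bij_betw (\<lambda>e. if e \<in> F p then \<theta> e else e) (F p) (F p)"
      by (rule bij_betw_cong[THEN iffD1, rotated]) simp
    then have "(\<lambda>e. if e \<in> F p then \<theta> e else e) permutes F p"
      by (rule bij_imp_permutes) simp
    then show "R \<theta> p \<in> {\<pi>. \<pi> permutes F p}" using \<open>p \<in> I\<close> by (simp add: R_def)
  qed (simp add: R_def)
  moreover have "finite (PiE I (\<lambda>p. {\<pi>. \<pi> permutes F p}))"
    using fin(2) finite_permutations[OF finF] by (intro finite_PiE) auto
  ultimately have "card S \<le> card (PiE I (\<lambda>p. {\<pi>. \<pi> permutes F p}))"
    by (rule card_inj_on_le)
  also have "\<dots> = (\<Prod>p\<in>I. fact (fibre_card E c p))"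
    unfolding card_PiE[OF fin(2)] fibre_card_def
    by (intro prod.cong refl card_permutations) (use finF in \<open>auto simp: F_def\<close>)
  finally show "card S \<le> (\<Prod>p\<in>I. fact (fibre_card E c p))" .
qed

text \<open>
  Two automorphisms with the same action on the vertices differ by a permutation of the edges that
  keeps every edge between the same two vertices.
\<close>

lemma card_Aut_le:
  fixes \<Gamma> :: "('v, 'e) cgraph"
  assumes co: "coordinates k \<Gamma> b w c" and fin: "finite (verts \<Gamma>)" "finite (edges \<Gamma>)"
  shows "card (Aut \<Gamma>) \<le>
           fact (card (verts \<Gamma>)) * (\<Prod>p\<in>{..<k} \<times> {..<k}. fact (fibre_card (edges \<Gamma>) c p))"
    (is "_ \<le> _ * ?P")
proof -
  note cD = coordinatesD[OF co]
  define S where "S = {\<theta>. \<theta> permutes edges \<Gamma> \<and> (\<forall>e\<in>edges \<Gamma>. c (\<theta> e) = c e)}"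
  have c: "c \<in> edges \<Gamma> \<rightarrow> {..<k} \<times> {..<k}" using co unfolding coordinates_def by simp
  have S: "finite S" "card S \<le> ?P"
    using card_fibre_preserving_permutations[OF fin(2) _ c] unfolding S_def by auto
  have fibre: "card {\<psi>. (\<phi>, \<psi>) \<in> Aut \<Gamma>} \<le> ?P" for \<phi>
  proof (cases "\<exists>\<psi>. (\<phi>, \<psi>) \<in> Aut \<Gamma>")
    case True
    then obtain \<psi>\<^sub>0 where p0: "(\<phi>, \<psi>\<^sub>0) \<in> Aut \<Gamma>" by blast
    then have perm0: "\<psi>\<^sub>0 permutes edges \<Gamma>" unfolding Aut_def by simp
    have "inv \<psi>\<^sub>0 \<circ> \<psi> \<in> S" if p: "(\<phi>, \<psi>) \<in> Aut \<Gamma>" for \<psi>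
    proof -
      have perm: "\<psi> permutes edges \<Gamma>" using p unfolding Aut_def by simp
      have "c (inv \<psi>\<^sub>0 (\<psi> e)) = c e" if e: "e \<in> edges \<Gamma>" for e
      proof -
        define f where "f = inv \<psi>\<^sub>0 (\<psi> e)"
        have f: "\<psi>\<^sub>0 f = \<psi> e" unfolding f_def using permutes_inverses(1)[OF perm0] by simp
        then have "f \<in> edges \<Gamma>"
          using permutes_in_image[OF perm0, of f] permutes_in_image[OF perm, of e] e by simp
        have same: "(v, f) \<in> inc \<Gamma> \<longleftrightarrow> (v, e) \<in> inc \<Gamma>" if "v \<in> verts \<Gamma>" for v
        proof -
          have "(v, f) \<in> inc \<Gamma> \<longleftrightarrow> (\<phi> v, \<psi>\<^sub>0 f) \<in> inc \<Gamma>"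
            using p0 that \<open>f \<in> edges \<Gamma>\<close> unfolding Aut_def is_iso_def by simp
          also have "\<dots> \<longleftrightarrow> (v, e) \<in> inc \<Gamma>"
            unfolding f using p that e unfolding Aut_def is_iso_def by simp
          finally show ?thesis .
        qed
        have "fst (c e) = fst (c f)"
          using same[of "b (fst (c e))"] cD(3,7) cD(5)[OF e] e \<open>f \<in> edges \<Gamma>\<close> by simp
        moreover have "snd (c e) = snd (c f)"
          using same[of "w (snd (c e))"] cD(4,8) cD(6)[OF e] e \<open>f \<in> edges \<Gamma>\<close> by simp
        ultimately show ?thesis by (simp add: prod_eq_iff f_def)
      qed
      then show ?thesis
        using permutes_compose[OF perm permutes_inv[OF perm0]] unfolding S_def by simp
    qed
    then have "(\<lambda>\<psi>. inv \<psi>\<^sub>0 \<circ> \<psi>) ` {\<psi>. (\<phi>, \<psi>) \<in> Aut \<Gamma>} \<subseteq> S" by auto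
    moreover have "inj_on (\<lambda>\<psi>. inv \<psi>\<^sub>0 \<circ> \<psi>) {\<psi>. (\<phi>, \<psi>) \<in> Aut \<Gamma>}"
    proof (rule inj_onI)
      fix x y assume "inv \<psi>\<^sub>0 \<circ> x = inv \<psi>\<^sub>0 \<circ> y"
      then have "\<psi>\<^sub>0 \<circ> (inv \<psi>\<^sub>0 \<circ> x) = \<psi>\<^sub>0 \<circ> (inv \<psi>\<^sub>0 \<circ> y)" by simp
      then show "x = y" unfolding comp_assoc[symmetric] permutes_inv_o(1)[OF perm0] by simp
    qed
    ultimately have "card {\<psi>. (\<phi>, \<psi>) \<in> Aut \<Gamma>} \<le> card S"
      using S(1) by (intro card_inj_on_le)
    then show ?thesis using S(2) by simp
  next
    case False
    then have "{\<psi>. (\<phi>, \<psi>) \<in> Aut \<Gamma>} = {}" by auto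
    then show ?thesis by (simp only: card.empty)
  qed
  let ?V = "{\<phi>. \<phi> permutes verts \<Gamma>}"
  have "finite {\<psi>. (\<phi>, \<psi>) \<in> Aut \<Gamma>}" for \<phi>
    by (rule finite_subset[OF _ finite_permutations[OF fin(2)]]) (auto simp: Aut_def)
  then have "card (Sigma ?V (\<lambda>\<phi>. {\<psi>. (\<phi>, \<psi>) \<in> Aut \<Gamma>})) = (\<Sum>\<phi>\<in>?V. card {\<psi>. (\<phi>, \<psi>) \<in> Aut \<Gamma>})"
    using finite_permutations[OF fin(1)] by (intro card_SigmaI) auto
  also have "Sigma ?V (\<lambda>\<phi>. {\<psi>. (\<phi>, \<psi>) \<in> Aut \<Gamma>}) = Aut \<Gamma>" by (auto simp: Aut_def)
  also have "(\<Sum>\<phi>\<in>?V. card {\<psi>. (\<phi>, \<psi>) \<in> Aut \<Gamma>}) \<le> of_nat (card ?V) * ?P"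
    by (intro sum_bounded_above fibre)
  finally show ?thesis using card_permutations[OF refl fin(1)] by simp
qed

section \<open>Factorial estimates\<close>

text \<open>
  This is the bound \<open>2 ^ min a b \<le> (a + b) choose a\<close> without division. For \<open>a < b\<close>, increasing \<open>a\<close> by one
  multiplies the left-hand side by \<open>2 (a + 1)\<close> and the right-hand side by \<open>a + b + 1 \<ge> 2 (a + 1)\<close>.
\<close>

lemma two_power_min_fact_le: "2 ^ min a b * (fact a * fact b) \<le> (fact (a + b) :: nat)"
proof -
  have *: "2 ^ a * (fact a * fact b) \<le> (fact (a + b) :: nat)" if "a \<le> b" for a b
    using that
  proof (induction a)
    case (Suc a)
    have "2 ^ Suc a * (fact (Suc a) * fact b) = (2 * Suc a) * (2 ^ a * (fact a * fact b) :: nat)"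
      by (simp add: algebra_simps)
    also have "\<dots> \<le> Suc (a + b) * fact (a + b)"
      using Suc by (intro mult_mono) auto
    also have "\<dots> = fact (Suc a + b)" by simp
    finally show ?case .
  qed simp
  show ?thesis
  proof (cases "a \<le> b")
    case True
    then show ?thesis using *[OF True] by (simp add: min_def)
  next
    case False
    then show ?thesis using *[of b a] by (simp add: min_def ac_simps)
  qed
qed

lemma prod_fact_le_fact_sum:
  assumes "finite S"
  shows "(\<Prod>j\<in>S. fact (f j)) \<le> (fact (\<Sum>j\<in>S. f j) :: nat)"
  using assms
proof (induction S)
  case (insert x S)
  then have "(\<Prod>j\<in>insert x S. fact (f j)) \<le> fact (f x) * (fact (\<Sum>j\<in>S. f j) :: nat)" by simp
  also have "\<dots> \<le> fact (f x + (\<Sum>j\<in>S. f j))"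
    using fact_fact_dvd_fact[of "f x" "\<Sum>j\<in>S. f j"] by (intro dvd_imp_le) auto
  finally show ?case using insert by simp
qed simp

text \<open>
  The factorials of the entries in a row multiply to at most \<open>l!\<close>, as \<open>l!\<close> divided by their product is
  a multinomial coefficient. In row \<open>0\<close> that coefficient is at least the binomial coefficient of the
  first two entries, which gives the power of two.
\<close>

lemma contingency_prod_fact_le:
  assumes A: "A \<in> contingency k l" and k: "k \<ge> 2"
  shows "2 ^ min (A (0, 0)) (A (0, 1)) * (\<Prod>p\<in>{..<k} \<times> {..<k}. fact (A p)) \<le> (fact l ^ k :: nat)"
proof -
  define R :: "nat \<Rightarrow> nat" where "R i = (\<Prod>j<k. fact (A (i, j)))" for i
  have row: "(\<Sum>j<k. A (i, j)) = l" if "i < k" for i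
    using A that unfolding contingency_def by simp
  have R: "R i \<le> fact l" if "i < k" for i
    using prod_fact_le_fact_sum[of "{..<k}" "\<lambda>j. A (i, j)"] row[OF that] by (simp add: R_def)
  let ?m = "min (A (0, 0)) (A (0, 1))"
  have split: "{..<k} = insert 0 (insert 1 {2..<k})" using k by auto
  have R0: "2 ^ ?m * R 0 \<le> fact l"
  proof -
    have "2 ^ ?m * R 0 = 2 ^ ?m * (fact (A (0, 0)) * fact (A (0, 1))) * (\<Prod>j=2..<k. fact (A (0, j)))"
      unfolding R_def split by simp
    also have "\<dots> \<le> fact (A (0, 0) + A (0, 1)) * fact (\<Sum>j=2..<k. A (0, j))"
      by (intro mult_mono two_power_min_fact_le prod_fact_le_fact_sum) auto
    also have "\<dots> \<le> fact (A (0, 0) + A (0, 1) + (\<Sum>j=2..<k. A (0, j)))"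
      using fact_fact_dvd_fact by (intro dvd_imp_le) auto
    also have "A (0, 0) + A (0, 1) + (\<Sum>j=2..<k. A (0, j)) = l"
      using row[of 0] k unfolding split by simp
    finally show ?thesis .
  qed
  have "2 ^ ?m * (\<Prod>p\<in>{..<k} \<times> {..<k}. fact (A p)) = 2 ^ ?m * (\<Prod>i<k. R i)"
    unfolding R_def by (simp add: prod.cartesian_product)
  also have "(\<Prod>i<k. R i) = R 0 * (\<Prod>i=1..<k. R i)"
    using k prod.atLeast_Suc_lessThan[of 0 k R] by (simp add: atLeast0LessThan)
  also have "2 ^ ?m * (R 0 * (\<Prod>i=1..<k. R i)) \<le> fact l * (\<Prod>i=1..<k. fact l)"
    unfolding mult.assoc[symmetric] using R0 R by (intro mult_mono prod_mono) auto
  also have "\<dots> = fact l ^ k" using k by (simp add: power_eq_if)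
  finally show ?thesis .
qed

section \<open>Counting contingency matrices\<close>

lemma contingencyD:
  assumes "A \<in> contingency k l"
  shows "p \<notin> {..<k} \<times> {..<k} \<Longrightarrow> A p = 0"
    and "i < k \<Longrightarrow> (\<Sum>j<k. A (i, j)) = l" and "j < k \<Longrightarrow> (\<Sum>i<k. A (i, j)) = l"
  using assms unfolding contingency_def by blast+

lemma contingency_le:
  assumes "A \<in> contingency k l"
  shows "A p \<le> l"
proof (cases "p \<in> {..<k} \<times> {..<k}")
  case True
  then obtain i j where p: "p = (i, j)" "i < k" "j < k" by auto
  have "A (i, j) \<le> (\<Sum>j<k. A (i, j))" using p by (intro member_le_sum) auto
  then show ?thesis using contingencyD(2)[OF assms p(2)] p by simp
next
  case False
  then show ?thesis using contingencyD(1)[OF assms] by simp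
qed

lemma finite_contingency: "finite (contingency k l)"
proof -
  let ?F = "PiE ({..<k} \<times> {..<k}) (\<lambda>_. {..l})"
  have "inj_on (\<lambda>A. restrict A ({..<k} \<times> {..<k})) (contingency k l)"
  proof (rule inj_onI, rule ext)
    fix A B p
    assume AB: "A \<in> contingency k l" "B \<in> contingency k l"
      "restrict A ({..<k} \<times> {..<k}) = restrict B ({..<k} \<times> {..<k})"
    show "A p = B p"
      using fun_cong[OF AB(3), of p] contingencyD(1)[OF AB(1), of p] contingencyD(1)[OF AB(2), of p]
      by (cases "p \<in> {..<k} \<times> {..<k}") auto
  qed
  moreover have "(\<lambda>A. restrict A ({..<k} \<times> {..<k})) ` contingency k l \<subseteq> ?F"
    by (intro image_subsetI PiE_I) (auto simp: contingency_le)
  moreover have "finite ?F" by (intro finite_PiE) auto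
  ultimately show ?thesis by (rule inj_on_finite)
qed

text \<open>
  The block outside row \<open>r\<close> and column \<open>c\<close> determines the matrix: the row sums give the rest of column
  \<open>c\<close>, and then the column sums give row \<open>r\<close>.
\<close>

lemma contingency_eqI:
  assumes AB: "A \<in> contingency k l" "B \<in> contingency k l" and rc: "r < k" "c < k"
    and eq: "\<And>i j. i \<in> {..<k} - {r} \<Longrightarrow> j \<in> {..<k} - {c} \<Longrightarrow> A (i, j) = B (i, j)"
  shows "A = B"
proof -
  note A = contingencyD[OF AB(1)] and B = contingencyD[OF AB(2)]
  have row: "A (i, j) = B (i, j)" if i: "i < k" "i \<noteq> r" and j: "j < k" for i j
  proof (cases "j = c")
    case True
    have "A (i, c) + (\<Sum>j\<in>{..<k} - {c}. A (i, j)) = B (i, c) + (\<Sum>j\<in>{..<k} - {c}. B (i, j))"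
      using A(2)[OF i(1)] B(2)[OF i(1)] rc by (simp add: sum.remove[of "{..<k}" c])
    moreover have "(\<Sum>j\<in>{..<k} - {c}. A (i, j)) = (\<Sum>j\<in>{..<k} - {c}. B (i, j))"
      using i by (intro sum.cong eq) auto
    ultimately show ?thesis using True by simp
  qed (use that eq in auto)
  have "A (r, j) = B (r, j)" if j: "j < k" for j
  proof -
    have "A (r, j) + (\<Sum>i\<in>{..<k} - {r}. A (i, j)) = B (r, j) + (\<Sum>i\<in>{..<k} - {r}. B (i, j))"
      using A(3)[OF j] B(3)[OF j] rc by (simp add: sum.remove[of "{..<k}" r])
    moreover have "(\<Sum>i\<in>{..<k} - {r}. A (i, j)) = (\<Sum>i\<in>{..<k} - {r}. B (i, j))"
      using j by (intro sum.cong row) auto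
    ultimately show ?thesis by simp
  qed
  with row have "A (i, j) = B (i, j)" if "i < k" "j < k" for i j using that by (cases "i = r") auto
  then show ?thesis using A(1) B(1) by (intro ext) (metis SigmaE lessThan_iff)
qed

text \<open>
  The counting bound behind both estimates of exceptional matrices. A block outside one row and one
  column has \<open>(k - 1)\<^sup>2\<close> entries in \<open>{0, \<dots>, l}\<close>; in \<open>S\<close> the entry at \<open>p\<close> is a function of the others and of
  a parameter \<open>h\<close> that takes few values, so one factor \<open>l + 1\<close> is replaced by \<open>card X\<close>.
\<close>

lemma card_contingency_constrained:
  assumes S: "S \<subseteq> contingency k l" and rc: "r < k" "c < k"
    and p: "p \<in> ({..<k} - {r}) \<times> ({..<k} - {c})"
    and h: "h ` S \<subseteq> X" and X: "finite X"
    and det: "\<And>A B. A \<in> S \<Longrightarrow> B \<in> S \<Longrightarrow> h A = h B \<Longrightarrow>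
                (\<And>q. q \<in> ({..<k} - {r}) \<times> ({..<k} - {c}) - {p} \<Longrightarrow> A q = B q) \<Longrightarrow> A p = B p"
  shows "card S \<le> card X * (l + 1) ^ ((k - 1)\<^sup>2 - 1)"
proof -
  define P where "P = ({..<k} - {r}) \<times> ({..<k} - {c}) - {p}"
  define f where "f A = (h A, restrict A P)" for A
  have "inj_on f S"
  proof (rule inj_onI)
    fix A B assume AB: "A \<in> S" "B \<in> S" "f A = f B"
    then have "h A = h B" and res: "restrict A P = restrict B P" by (auto simp: f_def)
    have eq: "A q = B q" if "q \<in> P" for q
      using fun_cong[OF res, of q] that by simp
    then have "A p = B p" using det[OF AB(1,2) \<open>h A = h B\<close>] by (simp add: P_def)
    with eq have "A (i, j) = B (i, j)" if "i \<in> {..<k} - {r}" "j \<in> {..<k} - {c}" for i j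
      using that unfolding P_def by (cases "(i, j) = p") auto
    then show "A = B" using AB S rc by (intro contingency_eqI[of A k l B r c]) auto
  qed
  moreover have "f ` S \<subseteq> X \<times> PiE P (\<lambda>_. {..l})"
  proof (intro image_subsetI)
    fix A assume A: "A \<in> S"
    then have "A \<in> contingency k l" using S by auto
    then have "restrict A P \<in> PiE P (\<lambda>_. {..l})"
      by (intro PiE_I) (auto simp: contingency_le)
    then show "f A \<in> X \<times> PiE P (\<lambda>_. {..l})" using A h by (auto simp: f_def)
  qed
  moreover have finP: "finite P" by (simp add: P_def)
  then have "finite (X \<times> PiE P (\<lambda>_. {..l}))" using X by (intro finite_cartesian_product finite_PiE) auto
  ultimately have "card S \<le> card (X \<times> PiE P (\<lambda>_. {..l}))" by (rule card_inj_on_le)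
  also have "\<dots> = card X * (l + 1) ^ card P"
    using card_PiE[OF finP, of "\<lambda>_. {..l}"] by (simp add: card_cartesian_product)
  also have "card P = (k - 1)\<^sup>2 - 1"
    using p rc unfolding P_def by (simp add: card_cartesian_product power2_eq_square)
  finally show ?thesis .
qed

lemma card_contingency_small_entry:
  assumes k: "k \<ge> 2" and p: "p \<in> {..<k} \<times> {..<k}"
  shows "card {A \<in> contingency k l. (A p)\<^sup>2 < l} \<le>
           card {x::nat. x\<^sup>2 < l} * (l + 1) ^ ((k - 1)\<^sup>2 - 1)"
proof -
  have "\<exists>r<k. r \<noteq> i" for i using k by (intro exI[of _ "if i = 0 then 1 else 0"]) auto
  then obtain r c where rc: "r < k" "r \<noteq> fst p" "c < k" "c \<noteq> snd p" by metis
  have "x < l" if "x\<^sup>2 < l" for x :: nat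
    using that self_le_power[of x 2] by (cases "x = 0") auto
  then have "{x::nat. x\<^sup>2 < l} \<subseteq> {..<l}" by auto
  then have fin: "finite {x::nat. x\<^sup>2 < l}" by (rule finite_subset) simp
  have pP: "p \<in> ({..<k} - {r}) \<times> ({..<k} - {c})" using p rc by (auto simp: mem_Times_iff)
  show ?thesis
    by (rule card_contingency_constrained[where h = "\<lambda>A. A p", OF _ rc(1,3) pP _ fin]) auto
qed

text \<open>
  As \<open>k \<ge> 3\<close>, some row and some column avoid both positions. Both are then in one block of free
  entries, and the entry at \<open>q\<close> determines the entry at \<open>p\<close>.
\<close>

lemma card_contingency_equal_entries:
  assumes k: "k \<ge> 3" and p: "p \<in> {..<k} \<times> {..<k}" and q: "q \<in> {..<k} \<times> {..<k}" and "p \<noteq> q"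
  shows "card {A \<in> contingency k l. A p = A q} \<le> (l + 1) ^ ((k - 1)\<^sup>2 - 1)"
proof -
  have "\<exists>r<k. r \<noteq> i \<and> r \<noteq> j" for i j
  proof -
    have "card {i, j} \<le> 2" by (simp add: card_insert_if)
    then have "\<not> {..<k} \<subseteq> {i, j}" using k card_mono[of "{i, j}" "{..<k}"] by auto
    then show ?thesis by auto
  qed
  then obtain r c where rc: "r < k" "r \<noteq> fst p" "r \<noteq> fst q" "c < k" "c \<noteq> snd p" "c \<noteq> snd q"
    by metis
  let ?P = "({..<k} - {r}) \<times> ({..<k} - {c})"
  have pP: "p \<in> ?P" and qP: "q \<in> ?P - {p}"
    using p q rc \<open>p \<noteq> q\<close> by (auto simp: mem_Times_iff)
  have "card {A \<in> contingency k l. A p = A q} \<le> card {()} * (l + 1) ^ ((k - 1)\<^sup>2 - 1)"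
  proof (rule card_contingency_constrained[where h = "\<lambda>_. ()", OF _ rc(1,4) pP])
    fix A B assume "A \<in> {A \<in> contingency k l. A p = A q}" "B \<in> {A \<in> contingency k l. A p = A q}"
      and "\<And>q. q \<in> ?P - {p} \<Longrightarrow> A q = B q"
    then show "A p = B p" using qP by simp
  qed auto
  then show ?thesis by simp
qed

text \<open>
  For \<open>k = 2\<close> the entries cannot be distinct: the sums force \<open>A (0, 0) = A (1, 1)\<close>, and the exchange of both
  rows and both columns fixes every matrix. The other two conditions are \<open>\<surd>l \<le> A (0, 0)\<close> and
  \<open>\<surd>l \<le> A (0, 1)\<close>.
\<close>

definition generic :: "nat \<Rightarrow> nat \<Rightarrow> (nat \<times> nat \<Rightarrow> nat) \<Rightarrow> bool" where
  "generic k l A \<longleftrightarrow> (k \<ge> 3 \<longrightarrow> inj_on A ({..<k} \<times> {..<k})) \<and>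
     l \<le> (A (0, 0))\<^sup>2 \<and> l \<le> (A (0, 1))\<^sup>2"

text \<open>
  A union bound: there are at most \<open>k ^ 4\<close> pairs of positions whose entries could coincide, and two
  positions whose entries could be small.
\<close>

lemma card_not_generic:
  assumes k: "k \<ge> 2"
  shows "card {A \<in> contingency k l. \<not> generic k l A} \<le>
           (k ^ 4 + 2 * card {x::nat. x\<^sup>2 < l}) * (l + 1) ^ ((k - 1)\<^sup>2 - 1)"
    (is "card ?N \<le> (_ + 2 * ?s) * ?L")
proof -
  let ?sq = "{..<k} \<times> {..<k}"
  define D where "D = {(p, q) \<in> ?sq \<times> ?sq. p \<noteq> q \<and> k \<ge> 3}"
  define E where "E = (\<lambda>(p, q). {A \<in> contingency k l. A p = A q})"
  define Z where "Z p = {A \<in> contingency k l. (A p)\<^sup>2 < l}" for p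
  have D: "D \<subseteq> ?sq \<times> ?sq" by (auto simp: D_def)
  have "finite D" by (rule finite_subset[OF D]) simp
  have "card D \<le> card (?sq \<times> ?sq)" by (rule card_mono[OF _ D]) simp
  also have "\<dots> = k ^ 4" by (simp add: card_cartesian_product power_numeral_reduce)
  finally have cD: "card D \<le> k ^ 4" .
  have "?N \<subseteq> (\<Union>d\<in>D. E d) \<union> (Z (0, 0) \<union> Z (0, 1))"
  proof
    fix A assume A: "A \<in> ?N"
    show "A \<in> (\<Union>d\<in>D. E d) \<union> (Z (0, 0) \<union> Z (0, 1))"
    proof (cases "k \<ge> 3 \<and> \<not> inj_on A ?sq")
      case True
      then obtain p q where "p \<in> ?sq" "q \<in> ?sq" "A p = A q" "p \<noteq> q" unfolding inj_on_def by blast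
      then have "(p, q) \<in> D" "A \<in> E (p, q)" using True A unfolding D_def E_def by auto
      then show ?thesis by blast
    next
      case False
      then show ?thesis using A unfolding generic_def Z_def by auto
    qed
  qed
  moreover have fin: "finite (E d)" "finite (Z p)" for d p
    unfolding E_def Z_def using finite_contingency by (auto split: prod.split)
  ultimately have "card ?N \<le> card ((\<Union>d\<in>D. E d) \<union> (Z (0, 0) \<union> Z (0, 1)))"
    using \<open>finite D\<close> by (intro card_mono) auto
  also have "\<dots> \<le> card (\<Union>d\<in>D. E d) + (card (Z (0, 0)) + card (Z (0, 1)))"
    by (rule order.trans[OF card_Un_le add_left_mono[OF card_Un_le]])
  also have "card (\<Union>d\<in>D. E d) \<le> (\<Sum>d\<in>D. card (E d))" by (rule card_UN_le[OF \<open>finite D\<close>])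
  also have "(\<Sum>d\<in>D. card (E d)) \<le> of_nat (card D) * ?L"
    by (rule sum_bounded_above)
      (auto simp: D_def E_def intro!: card_contingency_equal_entries simp del: One_nat_def)
  also have "of_nat (card D) * ?L \<le> k ^ 4 * ?L" using cD by (intro mult_right_mono) auto
  also have "card (Z (0, 0)) \<le> ?s * ?L"
    unfolding Z_def by (rule card_contingency_small_entry) (use k in auto)
  also have "card (Z (0, 1)) \<le> ?s * ?L"
    unfolding Z_def by (rule card_contingency_small_entry) (use k in auto)
  finally show ?thesis by (simp add: algebra_simps)
qed

text \<open>
  With \<open>k = n + 1\<close> and \<open>m = l div n\<close>, a block whose \<open>n\<^sup>2\<close> entries are at most \<open>m\<close> has row and column sums at
  most \<open>l\<close>, so that the last column and the last row, apart from the corner, can be filled in. The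
  corner is the sum of the block minus \<open>(n - 1) l\<close>. It is nonnegative if the entries of the block fall
  short of \<open>m\<close> by less than \<open>l div n\<^sup>2\<close>, and there are \<open>(l div n\<^sup>2) ^ n\<^sup>2\<close> such blocks.
\<close>

lemma card_contingency_ge:
  assumes n: "n \<ge> 1"
  shows "(l div n\<^sup>2) ^ (n\<^sup>2) \<le> card (contingency (Suc n) l)"
proof -
  define t where "t = l div n\<^sup>2"
  define m where "m = l div n"
  define X where "X = PiE ({..<n} \<times> {..<n}) (\<lambda>_. {..<t})"
  define B where "B x i j = m - x (i, j)" for x :: "nat \<times> nat \<Rightarrow> nat" and i j
  define F :: "(nat \<times> nat \<Rightarrow> nat) \<Rightarrow> nat \<times> nat \<Rightarrow> nat" where
    "F x = (\<lambda>(i, j).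
       if i < n \<and> j < n then B x i j
       else if i < n \<and> j = n then l - (\<Sum>j<n. B x i j)
       else if i = n \<and> j < n then l - (\<Sum>i<n. B x i j)
       else if i = n \<and> j = n then (\<Sum>i<n. \<Sum>j<n. B x i j) - (n - 1) * l
       else 0)" for x
  have nm: "n * m \<le> l" unfolding m_def by simp
  have tm: "t \<le> m" unfolding t_def m_def power2_eq_square using n by (intro div_le_mono2) auto
  have "F x \<in> contingency (Suc n) l" if x: "x \<in> X" for x
  proof -
    have xt: "x (i, j) < t" if "i < n" "j < n" for i j using x that unfolding X_def by auto
    have R: "(\<Sum>j<n. B x i j) \<le> l" for i
    proof -
      have "(\<Sum>j<n. B x i j) \<le> (\<Sum>j<n. m)" by (intro sum_mono) (simp add: B_def)
      then show ?thesis using nm by simp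
    qed
    have C: "(\<Sum>i<n. B x i j) \<le> l" for j
    proof -
      have "(\<Sum>i<n. B x i j) \<le> (\<Sum>i<n. m)" by (intro sum_mono) (simp add: B_def)
      then show ?thesis using nm by simp
    qed
    define T where "T = (\<Sum>i<n. \<Sum>j<n. B x i j)"
    have T': "T = (\<Sum>j<n. \<Sum>i<n. B x i j)" unfolding T_def by (rule sum.swap)
    have T: "(n - 1) * l \<le> T"
    proof (cases "t = 0")
      case True
      then have False using xt[of 0 0] n by simp
      then show ?thesis ..
    next
      case False
      \<comment> \<open>\<open>n\<^sup>2 (m + 1) \<ge> n l\<close> by rounding and \<open>n\<^sup>2 t \<le> l\<close>, and \<open>n\<^sup>2 (m + 1 - t)\<close> bounds \<open>T\<close> from below\<close>
      have "int m - int t + 1 \<le> int (B x i j)" if "i < n" "j < n" for i j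
        using xt[OF that] tm unfolding B_def by simp
      then have "(\<Sum>i<n. \<Sum>j<n. int m - int t + 1) \<le> (\<Sum>i<n. \<Sum>j<n. int (B x i j))"
        by (intro sum_mono) auto
      then have "int n * int n * (int m - int t + 1) \<le> int T" unfolding T_def by simp
      moreover have "int n * (int m + 1) \<ge> int l"
      proof -
        have "l < n * m + n" using n dividend_less_times_div[of n l] unfolding m_def by simp
        then have "int l < int (n * m + n)" by (simp only: of_nat_less_iff)
        then show ?thesis by (simp add: algebra_simps)
      qed
      then have "int n * (int n * (int m + 1)) \<ge> int n * int l" by (intro mult_left_mono) auto
      moreover have "int n * int n * int t \<le> int l"
      proof -
        have "n * n * t \<le> l" unfolding t_def power2_eq_square by simp
        then have "int (n * n * t) \<le> int l" by (simp only: of_nat_le_iff)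
        then show ?thesis by simp
      qed
      ultimately have "int n * int l - int l \<le> int T" by (simp add: algebra_simps)
      then have "int ((n - 1) * l) \<le> int T" using n by (simp add: of_nat_diff algebra_simps)
      then show ?thesis by (simp only: of_nat_le_iff)
    qed
    have F: "F x (i, j) = B x i j" "F x (i, n) = l - (\<Sum>j<n. B x i j)"
      "F x (n, j) = l - (\<Sum>i<n. B x i j)" if "i < n" "j < n" for i j
      using that by (simp_all add: F_def)
    have Fn: "F x (n, n) = T - (n - 1) * l" by (simp add: F_def T_def)
    \<comment> \<open>the last row and the last column have the right sum: \<open>G\<close> is the family of column or row sums\<close>
    have total: "(\<Sum>i<n. l - G i) + (T - (n - 1) * l) = l"
      if "\<And>i. G i \<le> l" "(\<Sum>i<n. G i) = T" for G
    proof -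
      have "(\<Sum>i<n. l - G i) = n * l - T"
        using that by (subst sum_subtractf_nat) auto
      moreover have "T \<le> n * l" using sum_mono[of "{..<n}" G "\<lambda>_. l"] that by simp
      moreover have "n * l = (n - 1) * l + l" using n by (simp add: algebra_simps)
      ultimately show ?thesis using T by linarith
    qed
    have "(\<Sum>j<Suc n. F x (i, j)) = l" if "i < Suc n" for i
    proof (cases "i = n")
      case True
      then show ?thesis
        using total[of "\<lambda>j. \<Sum>i<n. B x i j"] C T' F(3) Fn by (simp add: n[THEN less_le_trans[OF zero_less_one]])
    next
      case False
      then have i: "i < n" using that by simp
      have "(\<Sum>j<n. F x (i, j)) = (\<Sum>j<n. B x i j)" using F(1) i by (intro sum.cong) auto
      moreover have "F x (i, n) = l - (\<Sum>j<n. B x i j)" using F(2)[OF i i] .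
      ultimately show ?thesis using R[of i] by simp
    qed
    moreover have "(\<Sum>i<Suc n. F x (i, j)) = l" if "j < Suc n" for j
    proof (cases "j = n")
      case True
      then show ?thesis
        using total[of "\<lambda>i. \<Sum>j<n. B x i j"] R T_def F(2) Fn by (simp add: n[THEN less_le_trans[OF zero_less_one]])
    next
      case False
      then have j: "j < n" using that by simp
      have "(\<Sum>i<n. F x (i, j)) = (\<Sum>i<n. B x i j)" using F(1) j by (intro sum.cong) auto
      moreover have "F x (n, j) = l - (\<Sum>i<n. B x i j)" using F(3)[OF j j] .
      ultimately show ?thesis using C[of j] by simp
    qed
    moreover have "F x p = 0" if "p \<notin> {..<Suc n} \<times> {..<Suc n}" for p
    proof -
      obtain i j where p: "p = (i, j)" by fastforce
      have "n < i \<or> n < j" using that unfolding p by auto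
      then consider "n < i" | "n < j" by blast
      then show ?thesis unfolding p F_def by cases simp_all
    qed
    ultimately show ?thesis unfolding contingency_def by blast
  qed
  then have "F ` X \<subseteq> contingency (Suc n) l" by auto
  moreover have "inj_on F X"
  proof (rule inj_onI)
    fix x y assume xy: "x \<in> X" "y \<in> X" "F x = F y"
    show "x = y"
    proof (rule PiE_ext[OF xy(1,2)[unfolded X_def]])
      fix p assume p: "p \<in> {..<n} \<times> {..<n}"
      then have "x p < t" "y p < t" using xy(1,2) unfolding X_def by auto
      moreover have "m - x p = m - y p"
        using fun_cong[OF xy(3), of p] p by (auto simp: F_def B_def)
      ultimately show "x p = y p" using tm by simp
    qed
  qed
  ultimately have "card X \<le> card (contingency (Suc n) l)"
    using finite_contingency by (intro card_inj_on_le)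
  then show ?thesis
    unfolding X_def t_def by (simp add: card_PiE card_cartesian_product power2_eq_square)
qed

section \<open>Isomorphism classes as orbits of matrices\<close>

text \<open>
  For a matrix in \<open>contingency k l\<close> this is an isomorphism class. Membership asks for some labelling
  with the matrix \<open>A\<close>, so all matrices in one orbit give the same class.
\<close>

definition graphs_with_matrix :: "nat \<Rightarrow> nat \<Rightarrow> (nat \<times> nat \<Rightarrow> nat) \<Rightarrow> (nat, nat) cgraph set" where
  "graphs_with_matrix k l A =
     {\<Gamma> \<in> kl_graphs k l. \<exists>b w c. coordinates k \<Gamma> b w c \<and> fibre_card (edges \<Gamma>) c = A}"

lemma kl_class_of_graph:
  assumes \<Gamma>: "\<Gamma> \<in> graphs_with_matrix k l A"
  shows "{(\<Gamma>, \<Delta>). \<Gamma> \<in> kl_graphs k l \<and> \<Delta> \<in> kl_graphs k l \<and> isomorphic \<Gamma> \<Delta>} `` {\<Gamma>} =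
           graphs_with_matrix k l A"
proof -
  obtain b w c where co: "coordinates k \<Gamma> b w c" and A: "fibre_card (edges \<Gamma>) c = A"
    and kl: "\<Gamma> \<in> kl_graphs k l"
    using \<Gamma> unfolding graphs_with_matrix_def by auto
  have fin: "finite (edges \<Delta>)" if "\<Delta> \<in> kl_graphs k l" for \<Delta>
    using that unfolding kl_graphs_def kl_bipartite_def by simp
  have "isomorphic \<Gamma> \<Delta> \<longleftrightarrow> \<Delta> \<in> graphs_with_matrix k l A" if \<Delta>: "\<Delta> \<in> kl_graphs k l" for \<Delta>
  proof
    assume "isomorphic \<Gamma> \<Delta>"
    then obtain \<phi> \<psi> where "is_iso \<Gamma> \<Delta> \<phi> \<psi>" unfolding isomorphic_def by blast
    from coordinates_transport[OF co this] show "\<Delta> \<in> graphs_with_matrix k l A"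
      unfolding graphs_with_matrix_def using \<Delta> A by auto
  next
    assume "\<Delta> \<in> graphs_with_matrix k l A"
    then obtain b' w' c' where "coordinates k \<Delta> b' w' c'" "fibre_card (edges \<Delta>) c' = A"
      unfolding graphs_with_matrix_def by blast
    then show "isomorphic \<Gamma> \<Delta>"
      using isomorphic_of_same_matrix[OF co _ fin[OF kl] fin[OF \<Delta>]] A by simp
  qed
  moreover have "graphs_with_matrix k l A \<subseteq> kl_graphs k l" unfolding graphs_with_matrix_def by auto
  ultimately show ?thesis using kl by auto
qed

lemma kl_graph_matrix:
  assumes "\<Gamma> \<in> kl_graphs k l"
  obtains A where "A \<in> contingency k l" "\<Gamma> \<in> graphs_with_matrix k l A"
proof -
  have kl: "kl_bipartite k l \<Gamma>" using assms unfolding kl_graphs_def by simp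
  then obtain b w c where co: "coordinates k \<Gamma> b w c" by (rule exists_coordinates)
  have "fibre_card (edges \<Gamma>) c \<in> contingency k l"
    using fibre_card_in_contingency[OF co] kl unfolding kl_bipartite_def by simp
  moreover have "\<Gamma> \<in> graphs_with_matrix k l (fibre_card (edges \<Gamma>) c)"
    using co assms unfolding graphs_with_matrix_def by blast
  ultimately show ?thesis by (rule that)
qed

text \<open>
  Every graph has a matrix, every matrix comes from a graph, and the matrices of a graph determine
  its class.
\<close>

lemma kl_classes_eq: "kl_classes k l = graphs_with_matrix k l ` contingency k l"
proof (intro equalityI subsetI)
  fix C assume "C \<in> kl_classes k l"
  then obtain \<Gamma> where \<Gamma>: "\<Gamma> \<in> kl_graphs k l"
    and C: "C = {(\<Gamma>, \<Delta>). \<Gamma> \<in> kl_graphs k l \<and> \<Delta> \<in> kl_graphs k l \<and> isomorphic \<Gamma> \<Delta>} `` {\<Gamma>}"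
    unfolding kl_classes_def quotient_def by blast
  obtain A where A: "A \<in> contingency k l" "\<Gamma> \<in> graphs_with_matrix k l A"
    using kl_graph_matrix[OF \<Gamma>] .
  then show "C \<in> graphs_with_matrix k l ` contingency k l"
    unfolding C kl_class_of_graph[OF A(2)] by blast
next
  fix C assume "C \<in> graphs_with_matrix k l ` contingency k l"
  then obtain A where A: "A \<in> contingency k l" and C: "C = graphs_with_matrix k l A" by blast
  obtain \<Gamma> :: "(nat, nat) cgraph" and b w c
    where "kl_bipartite k l \<Gamma>" "coordinates k \<Gamma> b w c" "fibre_card (edges \<Gamma>) c = A"
    using contingency_realised[OF A] .
  then have \<Gamma>: "\<Gamma> \<in> kl_graphs k l" "\<Gamma> \<in> graphs_with_matrix k l A"
    unfolding graphs_with_matrix_def kl_graphs_def by auto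
  show "C \<in> kl_classes k l"
    unfolding C kl_class_of_graph[OF \<Gamma>(2), symmetric] kl_classes_def using \<Gamma>(1)
    by (rule quotientI)
qed

text \<open>
  Matrices of the same class are matrices of one graph, hence differ by a permutation of the rows and
  one of the columns.
\<close>

lemma card_contingency_le_classes:
  "card (contingency k l) \<le> card (kl_classes k l) * (fact k)\<^sup>2"
proof -
  let ?G = "graphs_with_matrix k l"
  let ?\<Pi> = "{\<sigma>. \<sigma> permutes {..<k}}"
  define Fib where "Fib C = {A \<in> contingency k l. ?G A = C}" for C
  have "finite ?\<Pi>" by (rule finite_permutations) simp
  have "card ?\<Pi> = fact k" by (rule card_permutations) auto
  have "card (Fib C) \<le> (fact k)\<^sup>2" if C: "C \<in> kl_classes k l" for C
  proof -
    obtain A where A: "A \<in> contingency k l" "C = ?G A" using C unfolding kl_classes_eq by blast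
    obtain \<Gamma> :: "(nat, nat) cgraph" and b w c
      where \<Gamma>: "kl_bipartite k l \<Gamma>" "coordinates k \<Gamma> b w c" "fibre_card (edges \<Gamma>) c = A"
      using contingency_realised[OF A(1)] .
    then have "\<Gamma> \<in> ?G A" unfolding graphs_with_matrix_def kl_graphs_def by auto
    have "Fib C \<subseteq> (\<lambda>(\<sigma>, \<tau>). A \<circ> map_prod \<sigma> \<tau>) ` (?\<Pi> \<times> ?\<Pi>)"
    proof
      fix B assume "B \<in> Fib C"
      then have "\<Gamma> \<in> ?G B" using \<open>\<Gamma> \<in> ?G A\<close> A(2) unfolding Fib_def by simp
      then obtain b' w' c' where co': "coordinates k \<Gamma> b' w' c'" and B: "fibre_card (edges \<Gamma>) c' = B"
        unfolding graphs_with_matrix_def by blast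
      obtain \<sigma> \<tau> where "\<sigma> permutes {..<k}" "\<tau> permutes {..<k}" "B = A \<circ> map_prod \<sigma> \<tau>"
        using change_of_coordinates[OF \<Gamma>(2) co'] unfolding \<Gamma>(3) B by blast
      then show "B \<in> (\<lambda>(\<sigma>, \<tau>). A \<circ> map_prod \<sigma> \<tau>) ` (?\<Pi> \<times> ?\<Pi>)" by auto
    qed
    then have "card (Fib C) \<le> card (?\<Pi> \<times> ?\<Pi>)"
      using \<open>finite ?\<Pi>\<close> by (intro surj_card_le) auto
    then show ?thesis using \<open>card ?\<Pi> = fact k\<close> by (simp add: card_cartesian_product power2_eq_square)
  qed
  then have "(\<Sum>C\<in>kl_classes k l. card (Fib C)) \<le> of_nat (card (kl_classes k l)) * (fact k)\<^sup>2"
    by (rule sum_bounded_above)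
  moreover have "contingency k l = (\<Union>C\<in>kl_classes k l. Fib C)"
    unfolding kl_classes_eq Fib_def by auto
  then have "card (contingency k l) \<le> (\<Sum>C\<in>kl_classes k l. card (Fib C))"
    using card_UN_le[OF finite_kl_classes, of Fib k l] by simp
  ultimately show ?thesis by simp
qed

section \<open>The asymptotic statement\<close>

text \<open>
  The vertex permutations cost a factor \<open>(2k)!\<close> and the smaller of the first two entries of row \<open>0\<close>,
  which is at least \<open>\<surd>l\<close>, gains a factor \<open>2\<close> to that power.
\<close>

lemma card_Aut_generic:
  assumes k: "k \<ge> 2" and l: "l \<ge> 1" and gen: "generic k l A" and A: "A \<in> contingency k l"
    and \<Gamma>: "\<Gamma> \<in> graphs_with_matrix k l A"
  shows "real (card (Aut \<Gamma>)) * 2 powr sqrt (real l) \<le> fact (2 * k) * fact l ^ k"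
proof -
  obtain b w c where co: "coordinates k \<Gamma> b w c" and cA: "fibre_card (edges \<Gamma>) c = A"
    and kl: "kl_bipartite k l \<Gamma>"
    using \<Gamma> unfolding graphs_with_matrix_def kl_graphs_def by auto
  let ?B = "{v \<in> verts \<Gamma>. colour \<Gamma> v = Black}" and ?W = "{v \<in> verts \<Gamma>. colour \<Gamma> v = White}"
  have fin: "finite (verts \<Gamma>)" "finite (edges \<Gamma>)" and BW: "card ?B = k" "card ?W = k"
    using kl unfolding kl_bipartite_def by auto
  have "verts \<Gamma> = ?B \<union> ?W" using colour.exhaust by auto
  also have "card \<dots> = 2 * k" using fin BW by (subst card_Un_disjoint) auto
  finally have verts: "card (verts \<Gamma>) = 2 * k" .
  define m where "m = min (A (0, 0)) (A (0, 1))"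
  let ?P = "\<Prod>p\<in>{..<k} \<times> {..<k}. fact (A p) :: nat"
  have "l \<le> m\<^sup>2" using gen unfolding generic_def m_def by (simp add: min_def)
  then have "real l \<le> (real m)\<^sup>2" by (metis of_nat_le_iff of_nat_power)
  then have "sqrt (real l) \<le> real m" by (rule real_le_lsqrt[rotated]) simp
  then have "2 powr sqrt (real l) \<le> 2 powr real m" by (intro powr_mono) auto
  then have two: "2 powr sqrt (real l) \<le> 2 ^ m" by (simp add: powr_realpow)
  have "card (Aut \<Gamma>) \<le> fact (2 * k) * ?P"
    using card_Aut_le[OF co fin] unfolding verts cA .
  then have "card (Aut \<Gamma>) * 2 ^ m \<le> fact (2 * k) * ?P * 2 ^ m" by (rule mult_right_mono) simp
  also have "\<dots> = fact (2 * k) * (2 ^ m * ?P)" by (simp only: ac_simps)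
  also have "\<dots> \<le> fact (2 * k) * fact l ^ k"
    using contingency_prod_fact_le[OF A k] unfolding m_def by (intro mult_left_mono) auto
  finally have "real (card (Aut \<Gamma>) * 2 ^ m) \<le> real (fact (2 * k) * fact l ^ k)"
    by (simp only: of_nat_le_iff)
  then have "real (card (Aut \<Gamma>)) * 2 ^ m \<le> fact (2 * k) * fact l ^ k" by simp
  moreover have "real (card (Aut \<Gamma>)) * 2 powr sqrt (real l) \<le> real (card (Aut \<Gamma>)) * 2 ^ m"
    using two by (intro mult_left_mono) auto
  ultimately show ?thesis by linarith
qed

lemma powr_le_two_powr_sqrt:
  "eventually (\<lambda>l::nat. K * real l powr c \<le> 2 powr sqrt (real l)) sequentially"
proof -
  have "((\<lambda>l::nat. real l powr c / 2 powr sqrt (real l)) \<longlonglongrightarrow> 0)" by real_asymp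
  then have "((\<lambda>l::nat. K * (real l powr c / 2 powr sqrt (real l))) \<longlonglongrightarrow> 0)"
    by (rule tendsto_mult_right_zero)
  then have "eventually (\<lambda>l::nat. K * (real l powr c / 2 powr sqrt (real l)) < 1) sequentially"
    by (rule order_tendstoD) simp
  then show ?thesis by eventually_elim (simp add: field_simps)
qed

lemma card_squares_less: "real (card {x::nat. x\<^sup>2 < l}) \<le> sqrt (real l) + 1"
proof -
  have "x \<le> nat \<lfloor>sqrt (real l)\<rfloor>" if "x\<^sup>2 < l" for x
  proof -
    have "(real x)\<^sup>2 \<le> real l" using that by (metis of_nat_le_iff of_nat_power less_imp_le)
    then have "real x \<le> sqrt (real l)" by (rule real_le_rsqrt)
    then show ?thesis by (simp add: le_nat_floor)
  qed
  then have "card {x::nat. x\<^sup>2 < l} \<le> card {..nat \<lfloor>sqrt (real l)\<rfloor>}" by (intro card_mono) auto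
  then have "real (card {x::nat. x\<^sup>2 < l}) \<le> real (Suc (nat \<lfloor>sqrt (real l)\<rfloor>))"
    by (simp only: of_nat_le_iff card_atMost)
  also have "\<dots> = real (nat \<lfloor>sqrt (real l)\<rfloor>) + 1" by simp
  also have "real (nat \<lfloor>sqrt (real l)\<rfloor>) \<le> sqrt (real l)" by (simp add: of_nat_floor)
  finally show ?thesis by simp
qed

text \<open>
  With \<open>N = (k - 1)\<^sup>2\<close>, the exceptional matrices number at most a constant times \<open>\<surd>l \<cdot> l ^ (N - 1)\<close>, and the
  classes number at least a constant times \<open>l ^ N\<close>.
\<close>

lemma card_not_generic_le_classes:
  assumes k: "k \<ge> 2"
  obtains K where "\<And>l. l \<ge> 2 * (k - 1)\<^sup>2 \<Longrightarrow>
    real (card {A \<in> contingency k l. \<not> generic k l A}) \<le> K / sqrt (real l) * real (card (kl_classes k l))"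
proof -
  define N where "N = (k - 1)\<^sup>2"
  have N: "N \<ge> 1" using k by (simp add: N_def Suc_le_eq)
  define a where "a = (real k ^ 4 + 4) * 2 ^ (N - 1)"
  define d where "d = (2 * real N) ^ N * (fact k)\<^sup>2"
  have "real (card {A \<in> contingency k l. \<not> generic k l A}) \<le>
          (a * d) / sqrt (real l) * real (card (kl_classes k l))"
    if l: "l \<ge> 2 * (k - 1)\<^sup>2" for l
  proof -
    let ?l = "real l"
    have l2: "l \<ge> 2 * N" using l by (simp add: N_def)
    then have l1: "l \<ge> 1" using N by simp
    then have sq1: "sqrt ?l \<ge> 1" by simp
    have "real (card {A \<in> contingency k l. \<not> generic k l A}) \<le>
            real ((k ^ 4 + 2 * card {x::nat. x\<^sup>2 < l}) * (l + 1) ^ (N - 1))"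
      unfolding N_def using card_not_generic[OF k] by (simp only: of_nat_le_iff)
    also have "\<dots> = (real k ^ 4 + 2 * real (card {x::nat. x\<^sup>2 < l})) * (?l + 1) ^ (N - 1)"
      by (simp add: add.commute)
    also have "\<dots> \<le> ((real k ^ 4 + 4) * sqrt ?l) * (2 * ?l) ^ (N - 1)"
    proof (intro mult_mono power_mono)
      have "real k ^ 4 * 1 \<le> real k ^ 4 * sqrt ?l" using sq1 by (intro mult_left_mono) auto
      then show "real k ^ 4 + 2 * real (card {x::nat. x\<^sup>2 < l}) \<le> (real k ^ 4 + 4) * sqrt ?l"
        using card_squares_less[of l] sq1 unfolding distrib_right by linarith
    qed (use l1 in auto)
    also have "\<dots> = a * sqrt ?l * ?l ^ (N - 1)" by (simp add: a_def power_mult_distrib)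
    also have "\<dots> = a / sqrt ?l * ?l ^ N"
      using N l1 by (cases N) (simp_all add: field_simps)
    also have "\<dots> \<le> a / sqrt ?l * (d * real (card (kl_classes k l)))"
    proof (rule mult_left_mono)
      \<comment> \<open>as \<open>2 N \<le> l\<close>, rounding \<open>l / N\<close> down loses at most a factor \<open>2\<close>\<close>
      have "l < N * (l div N) + N" using N dividend_less_times_div[of N l] by simp
      then have "l \<le> 2 * N * (l div N)" using l2 by linarith
      then have "real l \<le> real (2 * N * (l div N))" by (simp only: of_nat_le_iff)
      then have "?l ^ N \<le> (2 * real N * real (l div N)) ^ N" by (intro power_mono) auto
      also have "\<dots> = (2 * real N) ^ N * real ((l div N) ^ N)" by (simp add: power_mult_distrib)
      also have "\<dots> \<le> (2 * real N) ^ N * real (card (kl_classes k l) * (fact k)\<^sup>2)"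
      proof (intro mult_left_mono)
        have "(l div N) ^ N \<le> card (contingency k l)"
          using card_contingency_ge[of "k - 1" l] k by (simp add: N_def)
        also have "\<dots> \<le> card (kl_classes k l) * (fact k)\<^sup>2" by (rule card_contingency_le_classes)
        finally show "real ((l div N) ^ N) \<le> real (card (kl_classes k l) * (fact k)\<^sup>2)"
          by (simp only: of_nat_le_iff)
      qed simp
      finally show "?l ^ N \<le> d * real (card (kl_classes k l))" by (simp add: d_def mult_ac)
    qed (simp add: a_def)
    finally show ?thesis by simp
  qed
  then show ?thesis by (rule that)
qed

theorem theorem1p2:
  fixes k :: nat and \<epsilon> :: real
  assumes "k \<ge> 2" and "\<epsilon> > 0"
  shows "(\<lambda>l::nat. measure_pmf.prob (pmf_of_set (kl_classes k l))
            {C. \<forall>\<Gamma>\<in>C.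
               (k \<ge> 3 \<longrightarrow> (\<forall>v\<in>verts \<Gamma>. \<forall>(\<phi>, \<psi>)\<in>Aut \<Gamma>. \<phi> v = v)) \<and>
               real (card (Aut \<Gamma>)) \<le> fact l ^ k / real l powr ((real k - 1)\<^sup>2 - \<epsilon>)})
         \<longlonglongrightarrow> 1"
    (is "(\<lambda>l. measure_pmf.prob _ (?Good l)) \<longlonglongrightarrow> 1")
proof -
  obtain K where K: "\<And>l. l \<ge> 2 * (k - 1)\<^sup>2 \<Longrightarrow>
      real (card {A \<in> contingency k l. \<not> generic k l A}) \<le>
        K / sqrt (real l) * real (card (kl_classes k l))"
    using card_not_generic_le_classes[OF assms(1)] by blast
  let ?p = "\<lambda>l. measure_pmf.prob (pmf_of_set (kl_classes k l)) (?Good l)"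
  let ?c = "(real k - 1)\<^sup>2 - \<epsilon>"
  have good: "graphs_with_matrix k l A \<in> ?Good l"
    if l: "l \<ge> 1" "fact (2 * k) * real l powr ?c \<le> 2 powr sqrt (real l)"
      and A: "A \<in> contingency k l" "generic k l A" for l A
  proof (intro CollectI ballI conjI impI)
    fix \<Gamma> assume \<Gamma>: "\<Gamma> \<in> graphs_with_matrix k l A"
    have "real (card (Aut \<Gamma>)) * real l powr ?c * fact (2 * k) \<le>
            real (card (Aut \<Gamma>)) * 2 powr sqrt (real l)"
      using mult_left_mono[OF l(2), of "real (card (Aut \<Gamma>))"] by (simp add: mult_ac)
    also have "\<dots> \<le> fact l ^ k * fact (2 * k)"
      using card_Aut_generic[OF assms(1) l(1) A(2,1) \<Gamma>] by (simp add: mult_ac)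
    finally have "real (card (Aut \<Gamma>)) * real l powr ?c \<le> fact l ^ k"
      by (rule mult_right_le_imp_le) simp
    then show "real (card (Aut \<Gamma>)) \<le> fact l ^ k / real l powr ?c"
      using l(1) by (simp add: pos_le_divide_eq)
    fix v x assume "k \<ge> 3" "v \<in> verts \<Gamma>" "x \<in> Aut \<Gamma>"
    moreover obtain b w c where "coordinates k \<Gamma> b w c" "fibre_card (edges \<Gamma>) c = A"
      using \<Gamma> unfolding graphs_with_matrix_def by blast
    ultimately show "case x of (\<phi>, \<psi>) \<Rightarrow> \<phi> v = v"
      using Aut_fixes_vertices A(2) unfolding generic_def by (cases x) auto
  qed
  have lower: "1 - K / sqrt (real l) \<le> ?p l"
    if l: "l \<ge> 2 * (k - 1)\<^sup>2" "l \<ge> 1" "fact (2 * k) * real l powr ?c \<le> 2 powr sqrt (real l)" for l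
  proof -
    let ?S = "kl_classes k l" and ?N = "{A \<in> contingency k l. \<not> generic k l A}"
    have pos: "real (card ?S) > 0"
      using finite_kl_classes kl_classes_nonempty by (simp add: card_gt_0_iff)
    \<comment> \<open>a class that is not good comes from a matrix that is not generic\<close>
    have "?S - ?Good l \<subseteq> graphs_with_matrix k l ` ?N"
      unfolding kl_classes_eq using good[OF l(2,3)] by blast
    then have "card (?S - ?Good l) \<le> card ?N"
      using finite_contingency by (intro surj_card_le) auto
    moreover have "card ?S = card (?S \<inter> ?Good l) + card (?S - ?Good l)"
      using finite_kl_classes by (simp only: card_Int_Diff)
    ultimately have "real (card ?S) \<le> real (card (?S \<inter> ?Good l)) + real (card ?N)" by linarith
    also have "\<dots> \<le> real (card (?S \<inter> ?Good l)) + K / sqrt (real l) * real (card ?S)"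
      using K[OF l(1)] by simp
    finally have "(1 - K / sqrt (real l)) * real (card ?S) \<le> real (card (?S \<inter> ?Good l))"
      by (simp add: algebra_simps)
    then have "1 - K / sqrt (real l) \<le> real (card (?S \<inter> ?Good l)) / real (card ?S)"
      using pos by (simp only: pos_le_divide_eq)
    then show ?thesis
      using measure_pmf_of_set[OF kl_classes_nonempty finite_kl_classes] by simp
  qed
  have "\<forall>\<^sub>F l in sequentially. 1 - K / sqrt (real l) \<le> ?p l"
    using powr_le_two_powr_sqrt[of "fact (2 * k)" ?c] eventually_ge_at_top[of "2 * (k - 1)\<^sup>2"]
      eventually_ge_at_top[of "1 :: nat"]
    by eventually_elim (rule lower)
  moreover have "\<forall>\<^sub>F l in sequentially. ?p l \<le> 1"
    by (intro always_eventually allI measure_pmf.prob_le_1)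
  moreover have "(\<lambda>l. 1 - K / sqrt (real l)) \<longlonglongrightarrow> 1" by real_asymp
  ultimately show ?thesis using tendsto_const by (rule tendsto_sandwich)
qed

end
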